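(* Let $n\ge2$, $k\ge0$ be integers, let $\hat\mu,\hat\nu\in P_k^+$ with corresponding partitions $\mu,\nu\in\mathcal P_{\le n-1,k}$, and let $d\in\mathbb Z_{\ge0}$. Let $\Gamma_{\hat\nu}^{\hat\mu}(d)$ be the set of lattice configurations on the cylinder with $n$ columns and $n-1$ rows, from $\hat\mu$ to $\hat\nu$, having exactly $2d$ outer horizontal edges (see context). Then $$|\Gamma_{\hat\nu}^{\hat\mu}(d)|=\sum_{\hat\lambda}\mathcal N_{\hat\lambda\hat\mu}^{(k),\hat\nu}\prod_{s\in\lambda}\frac{n-1+c(s)}{h(s)},$$ where the sum runs over those $\hat\lambda\in P_k^+$ (with corresponding partition $\lambda$) for which $d=\frac{|\lambda|+|\mu|-|\nu|}{n}+\nu_1-\mu_1$, and the product runs over the squares $s$ of the Young diagram of $\lambda$.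
   Context: $P_k^+$ is the set of level-$k$ dominant integral weights $\hat\lambda=\sum_{i=1}^n m_i\hat\omega_i$ of $\widehat{\mathfrak{su}}(n)$ ($m_i\in\mathbb Z_{\ge0}$, $\sum_i m_i=k$, with $\hat\omega_i$ the fundamental affine weights and label $n$ the affine node); $m(\hat\lambda)=(m_1,\dots,m_n)$ is the tuple of Dynkin labels. $\mathcal P_{\le n-1,k}$ is the set of partitions $\lambda=(\lambda_1\ge\dots\ge\lambda_{n-1}\ge0)$ with $\lambda_1\le k$. The two sets are in bijection via $m_i=\lambda_i-\lambda_{i+1}$ for $1\le i\le n-1$ (with $\lambda_n=0$), $m_n=k-\lambda_1$. For a square $s=(i,j)$ of the Young diagram of $\lambda$, $h(s)=\lambda_i+\lambda^t_j-i-j+1$ is the hook length and $c(s)=j-i$ the content. Lattice configurations ($\infty$-friendly walkers on the cylinder): a configuration from $\hat\mu$ to $\hat\nu$ is an assignment of non-negative integers to the edges of a square lattice on a cylinder with $n$ columns (indexed cyclically, modulo $n$) and $n-1$ rows, that is, vertical edge labels $m^{(i)}_j$ ($0\le i\le n-1$, $1\le j\le n$) and horizontal edge labels $a_{i,j}$ ($1\le i\le n-1$, $1\le j\le n$; $a_{i,j}$ is the number of walkers passing from column $j$ to column $j+1$ in row $i$), such that $m^{(0)}=m(\hat\mu)$, $m^{(n-1)}=m(\hat\nu)$ and for all $i,j$ $$a_{i,j}\le m^{(i-1)}_j,\qquad m^{(i)}_j=m^{(i-1)}_j-a_{i,j}+a_{i,j-1}\quad(\text{with }a_{i,0}=a_{i,n}).$$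 The outer horizontal edges are those between column $n$ and column $1$. Each walker passing the boundary contributes two outer edges (one at each end of the row, to be identified), so having $2d$ outer horizontal edges means $\sum_{i=1}^{n-1}a_{i,n}=d$. The fusion coefficients are defined by the Verlinde formula $$\mathcal N_{\hat\lambda\hat\mu}^{(k),\hat\nu}=\sum_{\sigma\in\mathcal P_{\le n-1,k}}\frac{S_{\lambda\sigma}S_{\mu\sigma}\overline{S_{\nu\sigma}}}{S_{\emptyset\sigma}},$$ where $\emptyset$ is the empty partition and $S$ is the (unitary) modular $S$-matrix given by $$S_{\lambda\sigma}=\frac{e^{i\pi n(n-1)/4}}{\sqrt{n(k+n)^{n-1}}}\sum_{w\in W}(-1)^{\ell(w)}e^{-\frac{2\pi i}{k+n}(\sigma+\rho,\,w(\lambda+\rho))}.$$ Here $W\cong \mathbb S_n$ is the Weyl group of $\mathfrak{su}(n)$, acting by permuting the coordinates of $\mathbb R^n$, a partition $\lambda$ is identified with the finite weight $(\lambda_1,\dots,\lambda_{n-1},0)-\frac{|\lambda|}{n}(1,\dots,1)\in\mathbb R^n$, $\rho=(\frac{n-1}{2},\frac{n-3}{2},\dots,-\frac{n-1}{2})$ is the Weyl vector, and $(\cdot,\cdot)$ is the standard inner product on $\mathbb R^n$. *)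

theory Defs
  imports Complex_Main "HOL-Combinatorics.Combinatorics" "HOL-Library.FuncSet"
begin

section \<open>Weights and partitions\<close>

text \<open>All finite tuples are 1-based functions on \<^typ>\<open>nat\<close>. Tuples of natural numbers vanish
  outside their index range, so that equality of functions is equality of tuples and
  the sets below are finite (proved below).\<close>

definition level_weights :: "nat \<Rightarrow> nat \<Rightarrow> (nat \<Rightarrow> nat) set" where
  "level_weights n k = {m. (\<forall>i. i \<notin> {1..n} \<longrightarrow> m i = 0) \<and> (\<Sum>i=1..n. m i) = k}"

definition box_partitions :: "nat \<Rightarrow> nat \<Rightarrow> (nat \<Rightarrow> nat) set" where
  "box_partitions n k = {lam. (\<forall>i. i \<notin> {1..n-1} \<longrightarrow> lam i = 0) \<and>
     (\<forall>i j. 1 \<le> i \<and> i \<le> j \<and> j \<le> n - 1 \<longrightarrow> lam j \<le> lam i) \<and> lam 1 \<le> k}"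

definition weight_of_partition :: "nat \<Rightarrow> nat \<Rightarrow> (nat \<Rightarrow> nat) \<Rightarrow> nat \<Rightarrow> nat" where
  "weight_of_partition n k lam i =
     (if i \<in> {1..n-1} then lam i - lam (i + 1) else if i = n then k - lam 1 else 0)"

text \<open>The inverse of the previous map, see \<open>bij_betw_weight_of_partition\<close> and
  \<open>weight_of_partition_inverse\<close> below.\<close>

definition partition_of_weight :: "nat \<Rightarrow> (nat \<Rightarrow> nat) \<Rightarrow> nat \<Rightarrow> nat" where
  "partition_of_weight n m i = (if i \<in> {1..n-1} then \<Sum>j=i..n-1. m j else 0)"

lemma box_partitions_Suc_le:
  assumes l: "l \<in> box_partitions n k" and i: "i \<ge> 1"
  shows "l (Suc i) \<le> l i"
proof (cases "Suc i \<le> n - 1")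
  case True
  then show ?thesis using l i by (simp add: box_partitions_def)
next
  case False
  then have "l (Suc i) = 0" using l by (simp add: box_partitions_def)
  then show ?thesis by simp
qed

lemma weight_of_partition_in:
  assumes n: "2 \<le> n" and l: "l \<in> box_partitions n k"
  shows "weight_of_partition n k l \<in> level_weights n k"
proof -
  note dec = box_partitions_Suc_le[OF l]
  have tel: "(\<Sum>i=1..p. l i - l (i+1)) + l (Suc p) = l 1" for p
  proof (induction p)
    case (Suc p)
    then show ?case using dec[of "Suc p"] by simp
  qed simp
  have ln: "l n = 0" "l 1 \<le> k" using l n by (auto simp: box_partitions_def)
  obtain p where p: "n = Suc p" using n by (cases n) auto
  have "(\<Sum>i=1..n. weight_of_partition n k l i) = (\<Sum>i=1..p. l i - l (i+1)) + (k - l 1)"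
    using p by (simp add: weight_of_partition_def)
  also have "\<dots> = k" using tel[of p] ln p by simp
  finally show ?thesis using n by (auto simp: level_weights_def weight_of_partition_def)
qed

lemma partition_of_weight_in:
  assumes n: "2 \<le> n" and m: "m \<in> level_weights n k"
  shows "partition_of_weight n m \<in> box_partitions n k"
proof -
  have "(\<Sum>j=1..n-1. m j) \<le> (\<Sum>j=1..n. m j)" by (rule sum_mono2) auto
  moreover have "(\<Sum>q=j..n-1. m q) \<le> (\<Sum>q=i..n-1. m q)" if "i \<le> j" for i j
    by (rule sum_mono2) (use that in auto)
  ultimately show ?thesis using m n
    by (auto simp: box_partitions_def level_weights_def partition_of_weight_def)
qed

lemma weight_of_partition_inverse:
  assumes n: "2 \<le> n" and l: "l \<in> box_partitions n k"
  shows "partition_of_weight n (weight_of_partition n k l) = l"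
proof
  fix i
  note dec = box_partitions_Suc_le[OF l]
  have tel: "(\<Sum>j=i..q. l j - l (j+1)) + l (Suc q) = l i" if "i \<le> q" "1 \<le> i" for q
    using that
  proof (induction q rule: dec_induct)
    case base
    then show ?case using dec[of i] by simp
  next
    case (step q)
    then show ?case using dec[of "Suc q"] by simp
  qed
  have ln: "l n = 0" "i \<notin> {1..n-1} \<Longrightarrow> l i = 0" using l n by (auto simp: box_partitions_def)
  show "partition_of_weight n (weight_of_partition n k l) i = l i"
  proof (cases "i \<in> {1..n-1}")
    case True
    have "(\<Sum>j=i..n-1. weight_of_partition n k l j) = (\<Sum>j=i..n-1. l j - l (j+1))"
      by (rule sum.cong) (use True in \<open>auto simp: weight_of_partition_def\<close>)
    then show ?thesis using True tel[of "n-1"] ln n by (simp add: partition_of_weight_def)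
  qed (use ln in \<open>auto simp: partition_of_weight_def\<close>)
qed

lemma partition_of_weight_inverse:
  assumes n: "2 \<le> n" and m: "m \<in> level_weights n k"
  shows "weight_of_partition n k (partition_of_weight n m) = m"
proof
  fix i
  obtain p where p: "n = Suc p" "1 \<le> p" using n by (cases n) auto
  have s: "(\<Sum>j=1..p. m j) + m n = k" "i \<notin> {1..n} \<Longrightarrow> m i = 0"
    using m p by (auto simp: level_weights_def)
  have "(\<Sum>j=i..p. m j) = m i + (\<Sum>j=Suc i..p. m j)" if "i \<le> p"
    using that by (simp add: sum.atLeast_Suc_atMost)
  then show "weight_of_partition n k (partition_of_weight n m) i = m i"
    using p s by (auto simp: weight_of_partition_def partition_of_weight_def)
qed

lemma bij_betw_weight_of_partition:
  assumes "2 \<le> n"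
  shows "bij_betw (weight_of_partition n k) (box_partitions n k) (level_weights n k)"
  by (rule bij_betw_byWitness[where f' = "partition_of_weight n"])
    (use assms in \<open>auto simp: weight_of_partition_inverse partition_of_weight_inverse
       weight_of_partition_in partition_of_weight_in\<close>)

lemma finite_bounded_support:
  fixes B :: nat
  assumes "finite A"
  shows "finite {f :: 'a \<Rightarrow> nat. \<forall>x. (x \<in> A \<longrightarrow> f x \<le> B) \<and> (x \<notin> A \<longrightarrow> f x = 0)}"
  using finite_set_of_finite_funs[OF assms, of "{..B}" 0] by simp

lemma level_weights_le: "m \<in> level_weights n k \<Longrightarrow> m i \<le> k"
  using member_le_sum[of i "{1..n}" m] by (cases "i \<in> {1..n}") (auto simp: level_weights_def)

lemma finite_level_weights: "finite (level_weights n k)"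
  by (rule finite_subset[OF _ finite_bounded_support[of "{1..n}" k]])
    (use level_weights_le in \<open>auto simp: level_weights_def\<close>)

lemma finite_box_partitions: "finite (box_partitions n k)"
proof (rule finite_subset[OF _ finite_bounded_support[of "{1..n-1}" k]])
  have "l i \<le> k" if "l \<in> box_partitions n k" "i \<in> {1..n-1}" for l i
    using that unfolding box_partitions_def by (auto intro: order_trans[of _ "l 1"])
  then show "box_partitions n k \<subseteq>
      {f. \<forall>x. (x \<in> {1..n-1} \<longrightarrow> f x \<le> k) \<and> (x \<notin> {1..n-1} \<longrightarrow> f x = 0)}"
    by (auto simp: box_partitions_def)
qed simp

section \<open>Young diagrams\<close>

definition psize :: "nat \<Rightarrow> (nat \<Rightarrow> nat) \<Rightarrow> nat" where
  "psize n lam = (\<Sum>i=1..n-1. lam i)"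

definition young_diagram :: "nat \<Rightarrow> (nat \<Rightarrow> nat) \<Rightarrow> (nat \<times> nat) set" where
  "young_diagram n lam = (SIGMA i:{1..n-1}. {1..lam i})"

definition transposed :: "nat \<Rightarrow> (nat \<Rightarrow> nat) \<Rightarrow> nat \<Rightarrow> nat" where
  "transposed n lam j = card {i \<in> {1..n-1}. j \<le> lam i}"

definition hook :: "nat \<Rightarrow> (nat \<Rightarrow> nat) \<Rightarrow> nat \<times> nat \<Rightarrow> int" where
  "hook n lam = (\<lambda>(i, j). int (lam i) + int (transposed n lam j) - int i - int j + 1)"

definition content :: "nat \<times> nat \<Rightarrow> int" where
  "content = (\<lambda>(i, j). int j - int i)"

section \<open>Lattice configurations on the cylinder\<close>

text \<open>A configuration is a pair \<open>(m, a)\<close>: \<open>m i j\<close> is the label of the vertical edge between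
  rows \<open>i\<close> and \<open>i + 1\<close> in column \<open>j\<close>, and \<open>a i j\<close> is the label of the horizontal edge
  in row \<open>i\<close> leaving column \<open>j\<close>. Labels outside the lattice are set to 0.\<close>

type_synonym config = "(nat \<Rightarrow> nat \<Rightarrow> nat) \<times> (nat \<Rightarrow> nat \<Rightarrow> nat)"

definition prev_col :: "nat \<Rightarrow> nat \<Rightarrow> nat" where
  "prev_col n j = (if j = 1 then n else j - 1)"

definition configs :: "nat \<Rightarrow> (nat \<Rightarrow> nat) \<Rightarrow> (nat \<Rightarrow> nat) \<Rightarrow> config set" where
  "configs n \<mu>h \<nu>h = {(m, a).
     (\<forall>i j. \<not> (i \<le> n - 1 \<and> j \<in> {1..n}) \<longrightarrow> m i j = 0) \<and>
     (\<forall>i j. \<not> (i \<in> {1..n-1} \<and> j \<in> {1..n}) \<longrightarrow> a i j = 0) \<and>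
     (\<forall>j\<in>{1..n}. m 0 j = \<mu>h j) \<and> (\<forall>j\<in>{1..n}. m (n - 1) j = \<nu>h j) \<and>
     (\<forall>i\<in>{1..n-1}. \<forall>j\<in>{1..n}. a i j \<le> m (i - 1) j \<and>
        m i j = m (i - 1) j - a i j + a i (prev_col n j))}"

text \<open>Every walker passing from column \<open>n\<close> to column 1 contributes two outer edges.\<close>

definition outer_edges :: "nat \<Rightarrow> config \<Rightarrow> nat" where
  "outer_edges n = (\<lambda>(m, a). 2 * (\<Sum>i=1..n-1. a i n))"

definition configs_outer :: "nat \<Rightarrow> (nat \<Rightarrow> nat) \<Rightarrow> (nat \<Rightarrow> nat) \<Rightarrow> nat \<Rightarrow> config set" where
  "configs_outer n \<mu>h \<nu>h d = {c \<in> configs n \<mu>h \<nu>h. outer_edges n c = 2 * d}"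

lemma sum_prev_col:
  fixes f :: "nat \<Rightarrow> nat"
  assumes "n \<ge> 1"
  shows "(\<Sum>j=1..n. f (prev_col n j)) = (\<Sum>j=1..n. f j)"
  by (rule sum.reindex_bij_witness[where j = "prev_col n"
        and i = "\<lambda>j. if j = n then 1 else j + 1"])
    (use assms in \<open>auto simp: prev_col_def\<close>)

lemma finite_configs_outer:
  assumes n: "2 \<le> n" and \<mu>: "\<mu>h \<in> level_weights n k"
  shows "finite (configs_outer n \<mu>h \<nu>h d)"
proof -
  let ?F = "{f :: nat \<times> nat \<Rightarrow> nat. \<forall>x. (x \<in> {..n} \<times> {..n} \<longrightarrow> f x \<le> k) \<and>
    (x \<notin> {..n} \<times> {..n} \<longrightarrow> f x = 0)}"
  have "configs n \<mu>h \<nu>h \<subseteq> (\<lambda>(f, g). (curry f, curry g)) ` (?F \<times> ?F)"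
  proof clarify
    fix m a assume c: "(m, a) \<in> configs n \<mu>h \<nu>h"
    have z: "m i j = 0" if "\<not> (i \<le> n - 1 \<and> j \<in> {1..n})" for i j
      using c that by (auto simp: configs_def)
    have za: "a i j = 0" if "\<not> (i \<in> {1..n-1} \<and> j \<in> {1..n})" for i j
      using c that by (auto simp: configs_def)
    have step: "a i j \<le> m (i - 1) j \<and> m i j = m (i - 1) j - a i j + a i (prev_col n j)"
      if "i \<in> {1..n-1}" "j \<in> {1..n}" for i j
      using c that unfolding configs_def by blast
    have row: "(\<Sum>j=1..n. m i j) = k" if "i \<le> n - 1" for i
      using that
    proof (induction i)
      case 0
      have "(\<Sum>j=1..n. m 0 j) = (\<Sum>j=1..n. \<mu>h j)"
        by (rule sum.cong) (use c in \<open>auto simp: configs_def\<close>)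
      then show ?case using \<mu> by (simp add: level_weights_def)
    next
      case (Suc i)
      have e: "m (Suc i) j + a (Suc i) j = m i j + a (Suc i) (prev_col n j)"
        if "j \<in> {1..n}" for j
        using step[of "Suc i" j] Suc.prems that by auto
      have "(\<Sum>j=1..n. m (Suc i) j) + (\<Sum>j=1..n. a (Suc i) j)
          = (\<Sum>j=1..n. m i j) + (\<Sum>j=1..n. a (Suc i) (prev_col n j))"
        unfolding sum.distrib[symmetric] by (rule sum.cong) (use e in auto)
      then show ?case using Suc sum_prev_col[of n "a (Suc i)"] n by simp
    qed
    have mk: "m i j \<le> k" for i j
    proof (cases "i \<le> n - 1 \<and> j \<in> {1..n}")
      case True
      then show ?thesis using member_le_sum[of j "{1..n}" "m i"] row[of i] by auto
    qed (simp add: z)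
    have ak: "a i j \<le> k" for i j
      using step[of i j] za[of i j] mk[of "i - 1" j]
      by (cases "i \<in> {1..n-1} \<and> j \<in> {1..n}") auto
    show "(m, a) \<in> (\<lambda>(f, g). (curry f, curry g)) ` (?F \<times> ?F)"
    proof (rule image_eqI[of _ _ "(case_prod m, case_prod a)"])
      show "(case_prod m, case_prod a) \<in> ?F \<times> ?F"
        using mk ak z za by auto
    qed (simp add: curry_def)
  qed
  moreover have "finite ?F"
    by (rule finite_bounded_support) simp
  ultimately have "finite (configs n \<mu>h \<nu>h)"
    by (meson finite_SigmaI finite_imageI finite_subset)
  then show ?thesis by (simp add: configs_outer_def)
qed

section \<open>Modular S-matrix and fusion coefficients\<close>

text \<open>Vectors of \<open>\<real>\<^sup>n\<close> are functions restricted to the indices \<open>{1..n}\<close>.\<close>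

definition fin_weight :: "nat \<Rightarrow> (nat \<Rightarrow> nat) \<Rightarrow> nat \<Rightarrow> real" where
  "fin_weight n lam i = real (lam i) - real (psize n lam) / real n"

definition weyl_vector :: "nat \<Rightarrow> nat \<Rightarrow> real" where
  "weyl_vector n i = (real n - 1) / 2 - (real i - 1)"

definition inner_prod :: "nat \<Rightarrow> (nat \<Rightarrow> real) \<Rightarrow> (nat \<Rightarrow> real) \<Rightarrow> real" where
  "inner_prod n x y = (\<Sum>i=1..n. x i * y i)"

definition weyl_act :: "(nat \<Rightarrow> nat) \<Rightarrow> (nat \<Rightarrow> real) \<Rightarrow> nat \<Rightarrow> real" where
  "weyl_act w x i = x (inv w i)"

text \<open>The character \<open>w \<mapsto> (-1)\<^bsup>\<ell>(w)\<^esup>\<close> of the Weyl group is the sign of the permutation \<open>w\<close>.\<close>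

definition S_matrix :: "nat \<Rightarrow> nat \<Rightarrow> (nat \<Rightarrow> nat) \<Rightarrow> (nat \<Rightarrow> nat) \<Rightarrow> complex" where
  "S_matrix n k lam \<sigma> =
     exp (\<i> * of_real (pi * real n * (real n - 1) / 4)) / of_real (sqrt (real n * real (k + n) ^ (n - 1)))
     * (\<Sum>w | w permutes {1..n}. of_int (sign w) *
          exp (- (2 * of_real pi * \<i> / of_nat (k + n)) *
            of_real (inner_prod n (\<lambda>i. fin_weight n \<sigma> i + weyl_vector n i)
               (weyl_act w (\<lambda>i. fin_weight n lam i + weyl_vector n i)))))"

definition fusion :: "nat \<Rightarrow> nat \<Rightarrow> (nat \<Rightarrow> nat) \<Rightarrow> (nat \<Rightarrow> nat) \<Rightarrow> (nat \<Rightarrow> nat) \<Rightarrow> complex" where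
  "fusion n k lam \<mu> \<nu> = (\<Sum>\<sigma>\<in>box_partitions n k.
     S_matrix n k lam \<sigma> * S_matrix n k \<mu> \<sigma> * cnj (S_matrix n k \<nu> \<sigma>) / S_matrix n k (\<lambda>_. 0) \<sigma>)"

end

theory Submission
  imports "Jordan_Normal_Form.Determinant" Defs
begin

text \<open>For a torus point \<open>y\<close> with \<open>\<Prod> y\<^sub>i = 1\<close> and equal \<open>(k+n)\<close>-th powers, the alternants
  \<open>\<psi>\<^sub>m = det (y\<^sub>i\<^bsup>(\<lambda>+\<rho>)\<^sub>j\<^esup>)\<close> form an eigenvector of the transfer matrix of one lattice row, with
  weight \<open>x\<close> per hop: the sum over all hops acts on each column of the determinant separately and
  produces a geometric sum.  The eigenvalue does not depend on \<open>m\<close>.  Comparing the \<open>(n-1)\<close>-row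
  configurations that start at \<open>\<mu>\<close> with those that start at the vacuum, where all walkers sit at
  site \<open>n\<close>, eliminates it.  Walkers starting at the vacuum never wrap around in \<open>n - 1\<close> rows, so
  their configurations are Gelfand-Tsetlin patterns: those ending at \<open>\<lambda>\<close> are counted by the
  dimension of a \<open>GL\<^bsub>n-1\<^esub>\<close>-module, that is, by the hook-content product, and have \<open>|\<lambda>|\<close> hops.
  Since \<open>S\<^bsub>\<lambda>\<sigma>\<^esub>\<close> is a constant multiple of the alternant at the point of \<open>\<sigma>\<close>, multiplying by
  \<open>cnj S\<^bsub>\<nu>\<sigma>\<^esub>\<close> and summing over \<open>\<sigma>\<close> isolates the configurations ending at \<open>\<nu>\<close>.  The number of
  hops and \<open>d\<close> determine each other once \<open>\<mu>\<close> and \<open>\<nu>\<close> are fixed.  Orthogonality of \<open>S\<close> is needed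
  only for weights whose sizes agree modulo \<open>n\<close>, where the fractional shift \<open>|\<lambda>|/n\<close> disappears.\<close>

section \<open>Determinants and the hook-content formula\<close>

text \<open>Multilinearity: the index chosen for column \<open>j\<close> occurs in that column only,
  so in each Leibniz term the sum over choice functions becomes a product of separate sums.\<close>

lemma det_sum_entries:
  fixes f :: "nat \<Rightarrow> nat \<Rightarrow> nat \<Rightarrow> 'a::comm_ring_1"
  assumes fin: "\<And>j. j < n \<Longrightarrow> finite (B j)"
  shows "(\<Sum>b\<in>PiE {..<n} B. det (mat n n (\<lambda>(i,j). f i j (b j))))
    = det (mat n n (\<lambda>(i,j). \<Sum>t\<in>B j. f i j t))"
proof -
  have lhs: "det (mat n n (\<lambda>(i,j). f i j (b j)))
    = (\<Sum>p | p permutes {0..<n}. signof p * (\<Prod>j<n. f (p j) j (b j)))" for b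
    by (subst det_col[of _ n]) (auto intro!: sum.cong prod.cong)
  have rhs: "det (mat n n (\<lambda>(i,j). \<Sum>t\<in>B j. f i j t))
    = (\<Sum>p | p permutes {0..<n}. signof p * (\<Prod>j<n. \<Sum>t\<in>B j. f (p j) j t))"
    by (subst det_col[of _ n]) (auto intro!: sum.cong prod.cong)
  have "(\<Prod>j<n. \<Sum>t\<in>B j. f (p j) j t) = (\<Sum>b\<in>PiE {..<n} B. \<Prod>j<n. f (p j) j (b j))" for p
    by (rule prod_sum_PiE) (auto simp: fin)
  then show ?thesis
    unfolding lhs rhs by (subst sum.swap) (simp add: sum_distrib_left)
qed

lemma det_scale_rows:
  fixes A :: "nat \<Rightarrow> nat \<Rightarrow> 'a::comm_ring_1"
  shows "det (mat n n (\<lambda>(i,j). c i * A i j)) = (\<Prod>i<n. c i) * det (mat n n (\<lambda>(i,j). A i j))"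
proof -
  have "det (mat n n (\<lambda>(i,j). B i j)) = (\<Sum>p | p permutes {0..<n}. signof p * (\<Prod>i<n. B i (p i)))"
    for B :: "nat \<Rightarrow> nat \<Rightarrow> 'a"
    by (subst det_def'[of _ n]) (auto intro!: sum.cong prod.cong simp: atLeast0LessThan)
  then show ?thesis
    by (simp add: prod.distrib sum_distrib_left mult_ac)
qed

lemma det_scale_cols:
  fixes A :: "nat \<Rightarrow> nat \<Rightarrow> 'a::comm_ring_1"
  shows "det (mat n n (\<lambda>(i,j). c j * A i j)) = (\<Prod>j<n. c j) * det (mat n n (\<lambda>(i,j). A i j))"
proof -
  have tr: "det (mat n n (\<lambda>(i,j). B i j)) = det (mat n n (\<lambda>(i,j). B j i))"
    for B :: "nat \<Rightarrow> nat \<Rightarrow> 'a"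
  proof -
    have "mat n n (\<lambda>(i,j). B j i) = transpose_mat (mat n n (\<lambda>(i,j). B i j))"
      by (rule eq_matI) auto
    then show ?thesis by (simp add: det_transpose[of _ n])
  qed
  show ?thesis
    by (subst (1 2) tr) (rule det_scale_rows)
qed

text \<open>Prefix sums of columns come from right multiplication by the upper triangular matrix
  with ones on and above the diagonal, whose determinant is 1.\<close>

lemma det_prefix_sums:
  fixes A :: "nat \<Rightarrow> nat \<Rightarrow> 'a::comm_ring_1"
  shows "det (mat n n (\<lambda>(i,j). \<Sum>q\<le>j. A i q)) = det (mat n n (\<lambda>(i,j). A i j))"
proof -
  define U :: "'a mat" where "U = mat n n (\<lambda>(i,j). if i \<le> j then 1 else 0)"
  have U: "U \<in> carrier_mat n n" by (simp add: U_def)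
  have "det U = prod_list (diag_mat U)"
    by (rule det_upper_triangular[OF _ U]) (auto simp: U_def upper_triangular_def)
  also have "\<dots> = 1"
    by (simp add: diag_mat_def U_def prod.list_conv_set_nth)
  finally have dU: "det U = 1" .
  have "mat n n (\<lambda>(i,j). \<Sum>q\<le>j. A i q) = mat n n (\<lambda>(i,j). A i j) * U"
  proof (rule eq_matI)
    fix i j assume "i < dim_row (mat n n (\<lambda>(i,j). A i j) * U)" "j < dim_col (mat n n (\<lambda>(i,j). A i j) * U)"
    then have ij: "i < n" "j < n" by (auto simp: U_def)
    have "(\<Sum>q<n. A i q * (if q \<le> j then 1 else 0)) = (\<Sum>q\<le>j. A i q)"
      by (rule sum.mono_neutral_cong_right) (use ij in auto)
    then show "mat n n (\<lambda>(i,j). \<Sum>q\<le>j. A i q) $$ (i, j) = (mat n n (\<lambda>(i,j). A i j) * U) $$ (i, j)"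
      using ij by (simp add: U_def scalar_prod_def atLeast0LessThan)
  qed (auto simp: U_def)
  then show ?thesis
    using det_mult[OF _ U, of "mat n n (\<lambda>(i,j). A i j)"] dU by simp
qed

text \<open>Prefix sums telescope the differences to the columns
  \<open>v i j - C * v i (n - 1)\<close>. These arise from \<open>v\<close> by right multiplication
  with \<open>W\<close>, the identity with \<open>C\<close> subtracted along its whole last row;
  \<open>W\<close> is lower triangular with diagonal 1, ..., 1, \<open>1 - C\<close>.\<close>

lemma det_cyclic_differences:
  fixes v :: "nat \<Rightarrow> nat \<Rightarrow> 'a::comm_ring_1"
  assumes n: "n > 0"
  shows "det (mat n n (\<lambda>(i,j). v i j - (if j = 0 then C * v i (n - 1) else v i (j - 1))))
    = (1 - C) * det (mat n n (\<lambda>(i,j). v i j))"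
proof -
  define W :: "'a mat" where "W = mat n n (\<lambda>(i,j). (if i = j then 1 else 0) - (if i = n - 1 then C else 0))"
  have W: "W \<in> carrier_mat n n" by (simp add: W_def)
  have "det W = prod_list (diag_mat W)"
    by (rule det_lower_triangular[OF _ W]) (auto simp: W_def)
  also have "\<dots> = (\<Prod>i<n. W $$ (i,i))"
    by (simp add: diag_mat_def W_def prod.list_conv_set_nth atLeast0LessThan)
  also have "\<dots> = (\<Prod>i<n. if i = n - 1 then 1 - C else 1)"
    by (rule prod.cong) (auto simp: W_def)
  also have "\<dots> = 1 - C" using n by simp
  finally have dW: "det W = 1 - C" .
  have pre: "(\<Sum>q\<le>j. v i q - (if q = 0 then C * v i (n - 1) else v i (q - 1))) = v i j - C * v i (n - 1)" for i j
    by (induction j) auto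
  have "mat n n (\<lambda>(i,j). v i j - C * v i (n - 1)) = mat n n (\<lambda>(i,j). v i j) * W"
  proof (rule eq_matI)
    fix i j assume "i < dim_row (mat n n (\<lambda>(i,j). v i j) * W)" "j < dim_col (mat n n (\<lambda>(i,j). v i j) * W)"
    then have ij: "i < n" "j < n" by (auto simp: W_def)
    have "(\<Sum>q<n. v i q * ((if q = j then 1 else 0) - (if q = n - 1 then C else 0))) = v i j - C * v i (n - 1)"
      using ij by (simp add: algebra_simps sum_subtractf if_distrib[of "\<lambda>x. _ * x"] cong: if_cong)
    then show "mat n n (\<lambda>(i,j). v i j - C * v i (n - 1)) $$ (i, j) = (mat n n (\<lambda>(i,j). v i j) * W) $$ (i, j)"
      using ij by (simp add: W_def scalar_prod_def atLeast0LessThan)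
  qed (auto simp: W_def)
  then have "det (mat n n (\<lambda>(i,j). v i j - C * v i (n - 1))) = (1 - C) * det (mat n n (\<lambda>(i,j). v i j))"
    using det_mult[OF _ W, of "mat n n (\<lambda>(i,j). v i j)"] dW by (simp add: mult.commute)
  then show ?thesis
    using det_prefix_sums[of n "\<lambda>i j. v i j - (if j = 0 then C * v i (n - 1) else v i (j - 1))"]
    by (simp add: pre)
qed

text \<open>Column differences turn the bottom row of ones into (1, 0, ..., 0), and Laplace
  expansion along it removes the first column. The cofactor sign \<open>(-1) ^ r\<close> cancels
  against the \<open>r\<close> negated rows of the minor.\<close>

lemma det_row_of_ones:
  fixes v :: "nat \<Rightarrow> nat \<Rightarrow> 'a::comm_ring_1"
  assumes one: "\<And>j. j \<le> r \<Longrightarrow> v r j = 1"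
  shows "det (mat r r (\<lambda>(i,j). v i j - v i (Suc j))) = det (mat (Suc r) (Suc r) (\<lambda>(i,j). v i j))"
proof -
  define u where "u i j = (if j = 0 then v i 0 else v i j - v i (j - 1))" for i j
  have pre: "(\<Sum>q\<le>j. u i q) = v i j" for i j
    by (induction j) (auto simp: u_def)
  have r0: "u r j = (if j = 0 then 1 else 0)" if "j \<le> r" for j
    using that one[of j] one[of "j - 1"] by (auto simp: u_def)
  define M where "M = mat (Suc r) (Suc r) (\<lambda>(i,j). u i j)"
  have M: "M \<in> carrier_mat (Suc r) (Suc r)" by (simp add: M_def)
  have "det (mat (Suc r) (Suc r) (\<lambda>(i,j). v i j)) = det M"
    using det_prefix_sums[of "Suc r" u] by (simp add: pre M_def)
  also have "\<dots> = (\<Sum>j<Suc r. M $$ (r, j) * cofactor M r j)"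
    by (rule laplace_expansion_row[OF M]) simp
  also have "\<dots> = (\<Sum>j<Suc r. if j = 0 then cofactor M r 0 else 0)"
    by (rule sum.cong) (auto simp: M_def r0)
  also have "\<dots> = cofactor M r 0" by simp
  also have "\<dots> = (-1) ^ r * det (mat_delete M r 0)" by (simp add: cofactor_def)
  also have "mat_delete M r 0 = mat r r (\<lambda>(i,j). (-1) * (v i j - v i (Suc j)))"
    by (rule eq_matI) (auto simp: mat_delete_def M_def u_def)
  also have "det \<dots> = (-1) ^ r * det (mat r r (\<lambda>(i,j). v i j - v i (Suc j)))"
    by (subst det_scale_rows) simp
  finally show ?thesis by (simp flip: power_mult_distrib mult.assoc)
qed

section \<open>Vandermonde and binomial determinants\<close>

text \<open>The coefficient matrix \<open>P\<close> expresses the polynomials in monomials. Degrees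
  fall from top to bottom, so \<open>P\<close> is upper triangular with unit diagonal.\<close>

lemma det_monic_polys:
  fixes x :: "nat \<Rightarrow> 'a::comm_ring_1" and p :: "nat \<Rightarrow> 'a poly"
  assumes deg: "\<And>d. d < r \<Longrightarrow> degree (p d) = d" and lc: "\<And>d. d < r \<Longrightarrow> coeff (p d) d = 1"
  shows "det (mat r r (\<lambda>(i,j). poly (p (r - 1 - i)) (x j))) = det (mat r r (\<lambda>(i,j). x j ^ (r - 1 - i)))"
proof -
  define P :: "'a mat" where "P = mat r r (\<lambda>(i,q). coeff (p (r - 1 - i)) (r - 1 - q))"
  have P: "P \<in> carrier_mat r r" by (simp add: P_def)
  have "det P = prod_list (diag_mat P)"
  proof (rule det_upper_triangular[OF _ P])
    show "upper_triangular P"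
      using deg by (auto simp: P_def upper_triangular_def intro!: coeff_eq_0)
  qed
  also have "\<dots> = (\<Prod>i<r. P $$ (i,i))"
    by (simp add: diag_mat_def P_def prod.list_conv_set_nth atLeast0LessThan)
  also have "\<dots> = 1"
  proof (rule prod.neutral, safe)
    fix i assume i: "i < r"
    then have "r - 1 - i < r" by simp
    then show "P $$ (i,i) = 1" using i lc[of "r - 1 - i"] by (simp add: P_def)
  qed
  finally have dP: "det P = 1" .
  have "mat r r (\<lambda>(i,j). poly (p (r - 1 - i)) (x j)) = P * mat r r (\<lambda>(i,j). x j ^ (r - 1 - i))"
  proof (rule eq_matI)
    fix i j assume "i < dim_row (P * mat r r (\<lambda>(i,j). x j ^ (r - 1 - i)))"
      "j < dim_col (P * mat r r (\<lambda>(i,j). x j ^ (r - 1 - i)))"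
    then have ij: "i < r" "j < r" by (auto simp: P_def)
    have "poly (p (r - 1 - i)) (x j) = (\<Sum>d\<le>r - 1 - i. coeff (p (r - 1 - i)) d * x j ^ d)"
      using ij deg[of "r - 1 - i"] by (simp add: poly_altdef)
    also have "\<dots> = (\<Sum>d<r. coeff (p (r - 1 - i)) d * x j ^ d)"
      proof (rule sum.mono_neutral_left)
      have "coeff (p (r - 1 - i)) d = 0" if "r - 1 - i < d" for d
        using that ij deg[of "r - 1 - i"] by (intro coeff_eq_0) auto
      then show "\<forall>d\<in>{..<r} - {..r - 1 - i}. coeff (p (r - 1 - i)) d * x j ^ d = 0" by auto
    qed (use ij in auto)
    also have "\<dots> = (\<Sum>q<r. coeff (p (r - 1 - i)) (r - 1 - q) * x j ^ (r - 1 - q))"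
      by (rule sum.reindex_bij_witness[of _ "\<lambda>q. r - 1 - q" "\<lambda>q. r - 1 - q"]) auto
    finally show "mat r r (\<lambda>(i,j). poly (p (r - 1 - i)) (x j)) $$ (i, j)
        = (P * mat r r (\<lambda>(i,j). x j ^ (r - 1 - i))) $$ (i, j)"
      using ij by (simp add: P_def scalar_prod_def atLeast0LessThan)
  qed (auto simp: P_def)
  then show ?thesis
    using det_mult[OF P, of "mat r r (\<lambda>(i,j). x j ^ (r - 1 - i))"] dP by simp
qed

lemma degree_prod_monic_linear:
  fixes c :: "nat \<Rightarrow> 'a::idom"
  shows "degree (\<Prod>q<d. [:- c q, 1:]) = d" "coeff (\<Prod>q<d. [:- c q, 1:]) d = 1"
proof -
  show *: "degree (\<Prod>q<d. [:- c q, 1:]) = d"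
    by (subst degree_prod_eq_sum_degree) auto
  have "lead_coeff (\<Prod>q<d. [:- c q, 1:]) = 1"
    unfolding lead_coeff_prod by simp
  then show "coeff (\<Prod>q<d. [:- c q, 1:]) d = 1"
    by (simp only: *)
qed

text \<open>In the Newton basis with nodes \<open>x (r - 1), x (r - 2), \<dots>\<close> the Vandermonde matrix is
  triangular.\<close>

lemma det_vandermonde:
  fixes x :: "nat \<Rightarrow> 'a::idom"
  shows "det (mat r r (\<lambda>(i,j). x j ^ (r - 1 - i))) = (\<Prod>i<r. \<Prod>j\<in>{i<..<r}. x i - x j)"
proof -
  define p where "p d = (\<Prod>q<d. [:- x (r - 1 - q), 1:])" for d
  define M where "M = mat r r (\<lambda>(i,j). poly (p (r - 1 - i)) (x j))"
  have M: "M \<in> carrier_mat r r" by (simp add: M_def)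
  have ev: "poly (p (r - 1 - i)) (x j) = (\<Prod>q\<in>{i<..<r}. x j - x q)" if "i < r" for i j
  proof -
    have "poly (p (r - 1 - i)) (x j) = (\<Prod>q<r - 1 - i. x j - x (r - 1 - q))"
      by (simp add: p_def poly_prod)
    also have "\<dots> = (\<Prod>q\<in>{i<..<r}. x j - x q)"
      by (rule prod.reindex_bij_witness[of _ "\<lambda>q. r - 1 - q" "\<lambda>q. r - 1 - q"]) auto
    finally show ?thesis .
  qed
  have "det (mat r r (\<lambda>(i,j). x j ^ (r - 1 - i))) = det M"
    unfolding M_def by (rule det_monic_polys[symmetric]) (simp_all add: p_def degree_prod_monic_linear)
  also have "\<dots> = prod_list (diag_mat M)"
  proof (rule det_lower_triangular[OF _ M])
    fix i j :: nat assume ij: "i < j" "j < r"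
    then have "(\<Prod>q\<in>{i<..<r}. x j - x q) = 0"
      by (intro prod_zero) auto
    then show "M $$ (i, j) = 0" using ij ev[of i j] by (simp add: M_def)
  qed
  also have "\<dots> = (\<Prod>i<r. M $$ (i,i))"
    by (simp add: diag_mat_def M_def prod.list_conv_set_nth atLeast0LessThan)
  also have "\<dots> = (\<Prod>i<r. \<Prod>j\<in>{i<..<r}. x i - x j)"
  proof (rule prod.cong[OF refl])
    fix i assume "i \<in> {..<r}"
    then show "M $$ (i,i) = (\<Prod>j\<in>{i<..<r}. x i - x j)" using ev[of i i] by (simp add: M_def)
  qed
  finally show ?thesis .
qed

text \<open>\<open>a choose d\<close> is \<open>1 / fact d\<close> times a monic polynomial of
  degree \<open>d\<close> in \<open>a\<close>, the falling factorial, so the factorials leave the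
  rows and a Vandermonde determinant remains.\<close>

lemma det_binomials:
  fixes l :: "nat \<Rightarrow> nat"
  shows "det (mat r r (\<lambda>(i,j). of_nat (l j choose (r - 1 - i)) :: 'a::field_char_0))
    = (\<Prod>i<r. (\<Prod>j\<in>{i<..<r}. of_nat (l i) - of_nat (l j)) / fact (r - 1 - i))"
proof -
  define p :: "nat \<Rightarrow> 'a poly" where "p d = (\<Prod>q<d. [:- of_nat q, 1:])" for d
  have ev: "of_nat (a choose d) = 1 / fact d * poly (p d) (of_nat a)" for a d
    by (simp add: binomial_gbinomial gbinomial_prod_rev p_def poly_prod atLeast0LessThan)
  have "det (mat r r (\<lambda>(i,j). of_nat (l j choose (r - 1 - i)) :: 'a))
      = (\<Prod>i<r. 1 / fact (r - 1 - i)) * det (mat r r (\<lambda>(i,j). poly (p (r - 1 - i)) (of_nat (l j))))"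
    unfolding ev by (rule det_scale_rows)
  also have "det (mat r r (\<lambda>(i,j). poly (p (r - 1 - i)) (of_nat (l j))))
      = det (mat r r (\<lambda>(i,j). of_nat (l j) ^ (r - 1 - i)))"
    by (rule det_monic_polys) (simp_all add: p_def degree_prod_monic_linear)
  finally show ?thesis
    unfolding det_vandermonde prod.distrib[symmetric] by simp
qed

section \<open>Hook lengths and contents\<close>

text \<open>The hook lengths in row \<open>i\<close> and the differences \<open>l i - l j\<close> with \<open>j > i\<close> exhaust
  \<open>{1..l i}\<close>.\<close>

lemma hook_row_product:
  fixes lam :: "nat \<Rightarrow> nat"
  assumes dec: "\<And>i j. 1 \<le> i \<Longrightarrow> i \<le> j \<Longrightarrow> j \<le> n - 1 \<Longrightarrow> lam j \<le> lam i"
    and i: "i \<in> {1..n-1}"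
  defines "l \<equiv> \<lambda>i. lam i + (n - 1 - i)"
  shows "(\<Prod>j=1..lam i. of_int (hook n lam (i,j))) * (\<Prod>j\<in>{i<..n-1}. of_nat (l i) - of_nat (l j))
    = (fact (l i) :: 'a::{comm_ring_1,semiring_char_0})"
proof -
  define T where "T = transposed n lam"
  \<comment> \<open>Column \<open>j\<close> is an initial segment of the rows because
    \<open>lam\<close> decreases, hence its length decides membership.\<close>
  have T_iff: "j \<le> lam i' \<longleftrightarrow> i' \<le> T j" if "i' \<in> {1..n-1}" for i' j
  proof
    assume "j \<le> lam i'"
    then have "{1..i'} \<subseteq> {q \<in> {1..n-1}. j \<le> lam q}"
      using that dec by (auto intro: order_trans)
    then have "card {1..i'} \<le> T j" unfolding T_def transposed_def by (intro card_mono) auto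
    then show "i' \<le> T j" by simp
  next
    assume le: "i' \<le> T j"
    show "j \<le> lam i'"
    proof (rule ccontr)
      assume "\<not> j \<le> lam i'"
      then have "q < i'" if "q \<in> {1..n-1}" "j \<le> lam q" for q
        using dec[of i' q] that \<open>i' \<in> {1..n-1}\<close> by (cases "q < i'") auto
      then have "{q \<in> {1..n-1}. j \<le> lam q} \<subseteq> {1..<i'}" by auto
      then have "T j \<le> card {1..<i'}" unfolding T_def transposed_def by (intro card_mono) auto
      then show False using le that by auto
    qed
  qed
  have T_le: "T j \<le> n - 1" for j
  proof -
    have "T j \<le> card {1..n-1}" unfolding T_def transposed_def by (rule card_mono) auto
    then show ?thesis by simp
  qed
  have T_anti: "T j' \<le> T j" if "j \<le> j'" for j j'
    unfolding T_def transposed_def by (rule card_mono) (use that in auto)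
  define h where "h j = (lam i - j) + (T j - i) + 1" for j
  have hook: "hook n lam (i,j) = int (h j)" if "j \<in> {1..lam i}" for j
    using that T_iff[OF i, of j] by (auto simp: hook_def h_def T_def of_nat_diff)
  have hdec: "h j' < h j" if "j < j'" "j' \<in> {1..lam i}" for j j'
    using that T_anti[of j j'] T_iff[OF i, of j'] by (auto simp: h_def)
  have inj_h: "inj_on h {1..lam i}"
  proof (rule inj_onI)
    fix a b assume ab: "a \<in> {1..lam i}" "b \<in> {1..lam i}" "h a = h b"
    then show "a = b" using hdec[of a b] hdec[of b a] by (cases a b rule: linorder_cases) auto
  qed
  have ldec: "l j' < l j" if "j < j'" "1 \<le> j" "j' \<le> n - 1" for j j'
    using that dec[of j j'] by (auto simp: l_def)
  define e where "e j = l i - l j" for j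
  have inj_e: "inj_on e {i<..n-1}"
  proof (rule inj_onI)
    fix a b assume ab: "a \<in> {i<..n-1}" "b \<in> {i<..n-1}" "e a = e b"
    then have "l a = l b" using ldec[of i a] ldec[of i b] i by (auto simp: e_def)
    then show "a = b" using ldec[of a b] ldec[of b a] ab by (cases a b rule: linorder_cases) auto
  qed
  \<comment> \<open>\<open>h j - e q\<close> equals \<open>(lam q - j) + (T j - q) + 1\<close>,
    which by \<open>T_iff\<close> is positive when \<open>j \<le> lam q\<close> and negative
    otherwise.\<close>
  have disj: "h ` {1..lam i} \<inter> e ` {i<..n-1} = {}"
  proof -
    have "h j \<noteq> e q" if j: "j \<in> {1..lam i}" and q: "q \<in> {i<..n-1}" for j q
    proof -
      have q': "q \<in> {1..n-1}" using q by auto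
      have b: "i \<le> T j" using T_iff[OF i, of j] j by auto
      have d: "lam q \<le> lam i" using dec[of i q] i q by auto
      have e: "int (e q) = int (lam i) - int (lam q) + int q - int i"
        using q i d by (auto simp: e_def l_def of_nat_diff)
      have h: "int (h j) = int (lam i) - int j + int (T j) - int i + 1"
        using b j by (auto simp: h_def of_nat_diff)
      show ?thesis
        using T_iff[OF q', of j] e h by (cases "j \<le> lam q") auto
    qed
    then show ?thesis by auto
  qed
  have sub: "h ` {1..lam i} \<union> e ` {i<..n-1} \<subseteq> {1..l i}"
  proof -
    have "h j \<in> {1..l i}" if "j \<in> {1..lam i}" for j
      using that T_le[of j] i by (auto simp: h_def l_def)
    moreover have "e q \<in> {1..l i}" if "q \<in> {i<..n-1}" for q
      using that ldec[of i q] i by (auto simp: e_def)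
    ultimately show ?thesis by blast
  qed
  \<comment> \<open>The \<open>lam i\<close> hook lengths and \<open>n - 1 - i\<close> differences
    are together \<open>l i\<close> distinct numbers inside \<open>{1..l i}\<close>.\<close>
  have "card (h ` {1..lam i} \<union> e ` {i<..n-1}) = l i"
    using i card_image[OF inj_h] card_image[OF inj_e] by (subst card_Un_disjoint[OF _ _ disj]) (auto simp: l_def)
  then have un: "h ` {1..lam i} \<union> e ` {i<..n-1} = {1..l i}"
    using sub by (intro card_subset_eq) auto
  have "(fact (l i) :: 'a) = (\<Prod>x\<in>h ` {1..lam i} \<union> e ` {i<..n-1}. of_nat x)"
    unfolding un by (simp add: fact_prod)
  also have "\<dots> = (\<Prod>j=1..lam i. of_nat (h j)) * (\<Prod>j\<in>{i<..n-1}. of_nat (e j))"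
    by (subst prod.union_disjoint[OF _ _ disj]) (simp_all only: prod.reindex[OF inj_h] prod.reindex[OF inj_e] o_def
        finite_imageI finite_atLeastAtMost finite_greaterThanAtMost)
  also have "(\<Prod>j=1..lam i. of_nat (h j)) = (\<Prod>j=1..lam i. of_int (hook n lam (i,j)) :: 'a)"
    by (rule prod.cong) (simp_all add: hook)
  also have "(\<Prod>j\<in>{i<..n-1}. of_nat (e j)) = (\<Prod>j\<in>{i<..n-1}. of_nat (l i) - of_nat (l j) :: 'a)"
    using ldec i by (intro prod.cong) (auto simp: e_def of_nat_diff less_imp_le)
  finally show ?thesis by simp
qed

lemma prod_shifted_eq_fact_quotient:
  "(\<Prod>j=1..a. of_int (int b + int j)) * fact b = (fact (a + b) :: 'a::{comm_ring_1,semiring_char_0})"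
proof (induction a)
  case (Suc a)
  have "(\<Prod>j=1..Suc a. of_int (int b + int j)) * fact b
      = of_int (int b + int (Suc a)) * ((\<Prod>j=1..a. of_int (int b + int j)) * (fact b :: 'a))"
    by (simp add: mult_ac)
  also have "\<dots> = fact (Suc a + b)"
    unfolding Suc.IH by (simp add: add_ac)
  finally show ?case .
qed simp

text \<open>In row \<open>i\<close> the numerators multiply to
  \<open>fact (l i) / fact (n - 1 - i)\<close> and the hook lengths to \<open>fact (l i)\<close>
  divided by the differences, so \<open>fact (l i)\<close> cancels. What is left is the product
  evaluation of the binomial determinant.\<close>

lemma hook_content_formula:
  fixes lam :: "nat \<Rightarrow> nat"
  assumes dec: "\<And>i j. 1 \<le> i \<Longrightarrow> i \<le> j \<Longrightarrow> j \<le> n - 1 \<Longrightarrow> lam j \<le> lam i"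
    and n: "n \<ge> 1"
  shows "(\<Prod>s\<in>young_diagram n lam. of_int (int n - 1 + content s) / of_int (hook n lam s))
    = det (mat (n-1) (n-1) (\<lambda>(i,j). of_nat (lam (Suc j) + (n - 1 - 1 - j) choose (n - 1 - 1 - i))
        :: 'a::field_char_0))"
proof -
  define l where "l i = lam i + (n - 1 - i)" for i
  have row: "(\<Prod>j=1..lam i. of_int (int n - 1 + content (i,j)) / of_int (hook n lam (i,j)))
    = (\<Prod>j\<in>{i<..n-1}. of_nat (l i) - of_nat (l j)) / (fact (n - 1 - i) :: 'a)"
    if i: "i \<in> {1..n-1}" for i
  proof -
    have H: "(\<Prod>j=1..lam i. of_int (hook n lam (i,j))) * (\<Prod>j\<in>{i<..n-1}. of_nat (l i) - of_nat (l j))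
      = (fact (l i) :: 'a)"
      unfolding l_def by (rule hook_row_product[OF dec i])
    have c: "int n - 1 + content (i,j) = int (n - 1 - i) + int j" for j
      using i by (auto simp: content_def)
    have C: "(\<Prod>j=1..lam i. of_int (int n - 1 + content (i,j))) * fact (n - 1 - i) = (fact (l i) :: 'a)"
      unfolding c l_def by (rule prod_shifted_eq_fact_quotient)
    have "(\<Prod>j=1..lam i. of_int (hook n lam (i,j)) :: 'a) \<noteq> 0"
    proof
      assume z: "(\<Prod>j=1..lam i. of_int (hook n lam (i,j)) :: 'a) = 0"
      show False using H unfolding z by simp
    qed
    then show ?thesis
      using H C unfolding prod_dividef by (simp add: frac_eq_eq mult_ac)
  qed
  have "(\<Prod>s\<in>young_diagram n lam. of_int (int n - 1 + content s) / of_int (hook n lam s))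
    = (\<Prod>i=1..n-1. \<Prod>j=1..lam i. of_int (int n - 1 + content (i,j)) / (of_int (hook n lam (i,j)) :: 'a))"
    unfolding young_diagram_def by (subst prod.Sigma) (auto simp: case_prod_beta)
  also have "\<dots> = (\<Prod>i=1..n-1. (\<Prod>j\<in>{i<..n-1}. of_nat (l i) - of_nat (l j)) / (fact (n - 1 - i) :: 'a))"
    by (rule prod.cong[OF refl row])
  also have "\<dots> = (\<Prod>i<n-1. (\<Prod>j\<in>{i<..<n-1}. of_nat (l (Suc i)) - of_nat (l (Suc j))) / fact (n - 1 - 1 - i))"
  proof (rule prod.reindex_bij_witness[of _ Suc "\<lambda>i. i - 1"])
    fix i assume i: "i \<in> {1..n-1}"
    have "(\<Prod>j\<in>{i-1<..<n-1}. of_nat (l (Suc (i - 1))) - of_nat (l (Suc j)) :: 'a)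
        = (\<Prod>j\<in>{i<..n-1}. of_nat (l i) - of_nat (l j))"
      by (rule prod.reindex_bij_witness[of _ "\<lambda>i. i - 1" Suc]) (use i in auto)
    moreover have "n - 1 - 1 - (i - 1) = n - 1 - i" using i by auto
    ultimately show "(\<Prod>j\<in>{i-1<..<n-1}. of_nat (l (Suc (i - 1))) - of_nat (l (Suc j))) / fact (n - 1 - 1 - (i - 1))
        = (\<Prod>j\<in>{i<..n-1}. of_nat (l i) - of_nat (l j)) / (fact (n - 1 - i) :: 'a)"
      by simp
  qed auto
  also have "\<dots> = det (mat (n-1) (n-1) (\<lambda>(i,j). of_nat (l (Suc j) choose (n - 1 - 1 - i)) :: 'a))"
    by (rule det_binomials[symmetric])
  also have "mat (n-1) (n-1) (\<lambda>(i,j). of_nat (l (Suc j) choose (n - 1 - 1 - i)) :: 'a)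
     = mat (n-1) (n-1) (\<lambda>(i,j). of_nat (lam (Suc j) + (n - 1 - 1 - j) choose (n - 1 - 1 - i)))"
    by (rule eq_matI) (auto simp: l_def)
  finally show ?thesis .
qed

section \<open>Hops and the transfer matrix\<close>

definition hop :: "nat \<Rightarrow> (nat \<Rightarrow> nat) \<Rightarrow> (nat \<Rightarrow> nat) \<Rightarrow> nat \<Rightarrow> nat" where
  "hop n m a j = (if j \<in> {1..n} then m j - a j + a (prev_col n j) else 0)"

definition hops_from :: "nat \<Rightarrow> (nat \<Rightarrow> nat) \<Rightarrow> (nat \<Rightarrow> nat) set" where
  "hops_from n m = {a. (\<forall>j. j \<notin> {1..n} \<longrightarrow> a j = 0) \<and> (\<forall>j\<in>{1..n}. a j \<le> m j)}"

text \<open>\<open>tail_sum n m j\<close> is the part \<open>\<lambda>\<^bsub>j+1\<^esub>\<close> of the partition of \<open>m\<close>, and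
  \<open>shifted_part n m j\<close> is \<open>(\<lambda> + \<rho>)\<^bsub>j+1\<^esub>\<close> up to a constant; both are indexed by \<open>j < n\<close>.\<close>

definition tail_sum :: "nat \<Rightarrow> (nat \<Rightarrow> nat) \<Rightarrow> nat \<Rightarrow> nat" where
  "tail_sum n m j = (\<Sum>i\<in>{j<..<n}. m i)"

definition shifted_part :: "nat \<Rightarrow> (nat \<Rightarrow> nat) \<Rightarrow> nat \<Rightarrow> nat" where
  "shifted_part n m j = tail_sum n m j + (n - 1 - j)"

text \<open>The numerator of the bialternant formula: a Schur polynomial times the Vandermonde
  determinant when \<open>L\<close> is a partition plus the staircase.\<close>

definition alternant :: "nat \<Rightarrow> (nat \<Rightarrow> 'a::comm_ring_1) \<Rightarrow> (nat \<Rightarrow> nat) \<Rightarrow> 'a" where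
  "alternant n y L = det (mat n n (\<lambda>(i,j). y i ^ L j))"

lemma finite_hops_from: "finite (hops_from n m)"
proof (rule finite_subset[OF _ finite_bounded_support[of "{1..n}" "\<Sum>j=1..n. m j"]])
  have "m j \<le> (\<Sum>j=1..n. m j)" if "j \<in> {1..n}" for j
    by (rule member_le_sum) (use that in auto)
  then show "hops_from n m \<subseteq> {f. \<forall>x. (x \<in> {1..n} \<longrightarrow> f x \<le> (\<Sum>j=1..n. m j)) \<and> (x \<notin> {1..n} \<longrightarrow> f x = 0)}"
    unfolding hops_from_def by (blast intro: order_trans)
qed simp

lemma hop_add:
  assumes "a \<in> hops_from n m" "j \<in> {1..n}"
  shows "hop n m a j + a j = m j + a (prev_col n j)"
proof -
  have "a j \<le> m j" using assms by (auto simp: hops_from_def)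
  then show ?thesis using assms(2) by (simp add: hop_def)
qed

lemma sum_hop:
  assumes n: "n \<ge> 1" and a: "a \<in> hops_from n m"
  shows "(\<Sum>j=1..n. hop n m a j) = (\<Sum>j=1..n. m j)"
proof -
  have "(\<Sum>j=1..n. hop n m a j) + (\<Sum>j=1..n. a j) = (\<Sum>j=1..n. m j + a (prev_col n j))"
    unfolding sum.distrib[symmetric]
    by (rule sum.cong) (simp_all only: hop_add[OF a])
  then show ?thesis using sum_prev_col[OF n, of a] by (simp add: sum.distrib)
qed

lemma hop_in_level_weights:
  assumes "n \<ge> 1" "m \<in> level_weights n k" "a \<in> hops_from n m"
  shows "hop n m a \<in> level_weights n k"
  using assms sum_hop[of n a m] by (auto simp: level_weights_def hop_def)

lemma tail_sum_Suc: "Suc j < n \<Longrightarrow> tail_sum n m j = m (Suc j) + tail_sum n m (Suc j)"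
proof -
  assume "Suc j < n"
  then have "{j<..<n} = insert (Suc j) {Suc j<..<n}" by auto
  then show ?thesis by (simp add: tail_sum_def)
qed

lemma tail_sum_last [simp]: "tail_sum n m (n - Suc 0) = 0"
  by (cases n) (auto simp: tail_sum_def intro!: sum.neutral)

lemma tail_sum_0:
  assumes "n \<ge> 1" "m \<in> level_weights n k"
  shows "tail_sum n m 0 + m n = k"
proof -
  have "{1..n} = insert n {0<..<n}" using assms by auto
  then show ?thesis using assms by (simp add: tail_sum_def level_weights_def)
qed

text \<open>Sites \<open>j + 1\<close> to \<open>n - 1\<close> gain the walkers entering site
  \<open>j + 1\<close> and lose those leaving site \<open>n - 1\<close>. For partitions: part
  \<open>j + 1\<close> grows by the arrivals, and then \<open>a (n - 1)\<close> columns of height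
  \<open>n\<close> are removed, which resets the last part to 0.\<close>

lemma tail_sum_hop:
  assumes n: "n \<ge> 2" and a: "a \<in> hops_from n m" and j: "j < n"
  shows "tail_sum n (hop n m a) j + a (n - 1) = tail_sum n m j + a (prev_col n (Suc j))"
  using j
proof (induction "n - 1 - j" arbitrary: j)
  case 0
  then have "j = n - 1" by simp
  then show ?case using n by (simp add: prev_col_def)
next
  case (Suc d)
  then have j: "Suc j < n" by simp
  have "tail_sum n (hop n m a) (Suc j) + a (n - 1) = tail_sum n m (Suc j) + a (prev_col n (Suc (Suc j)))"
    using Suc by (intro Suc.hyps) auto
  moreover have "hop n m a (Suc j) + a (Suc j) = m (Suc j) + a (prev_col n (Suc j))"
    using j by (intro hop_add[OF a]) auto
  moreover have "prev_col n (Suc (Suc j)) = Suc j" by (simp add: prev_col_def)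
  ultimately show ?case using j by (simp add: tail_sum_Suc)
qed

lemma partition_of_weight_eq_tail_sum:
  "partition_of_weight n m (Suc j) = tail_sum n m j"
proof -
  have "{Suc j..n-1} = {j<..<n}" by auto
  moreover have "tail_sum n m j = 0" if "\<not> Suc j \<le> n - 1"
    using that by (auto simp: tail_sum_def intro!: sum.neutral)
  ultimately show ?thesis by (auto simp: partition_of_weight_def tail_sum_def)
qed

lemma sum_tail_sum:
  assumes "n \<ge> 1"
  shows "(\<Sum>j<n. tail_sum n m j) = psize n (partition_of_weight n m)"
proof -
  obtain r where r: "n = Suc r" using assms by (cases n) auto
  have "(\<Sum>j<r. tail_sum n m j) = (\<Sum>i=1..r. partition_of_weight n m i)"
    by (rule sum.reindex_bij_witness[of _ "\<lambda>i. i - 1" Suc])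
      (auto simp: partition_of_weight_eq_tail_sum)
  then show ?thesis using tail_sum_last[of n m] by (simp add: r psize_def)
qed

text \<open>Matches each column of the alternant with the site whose outgoing walkers raise its
  exponent.\<close>

lemma bij_prev_col_Suc:
  assumes "n \<ge> 1"
  shows "bij_betw (\<lambda>j. prev_col n (Suc j)) {..<n} {1..n}"
  by (rule bij_betw_byWitness[where f' = "\<lambda>t. if t = n then 0 else t"])
    (use assms in \<open>auto simp: prev_col_def\<close>)

text \<open>Every hop adds a box, and every hop out of site \<open>n - 1\<close> also completes a
  column of \<open>n\<close> boxes, which is dropped.\<close>

lemma psize_hop:
  assumes n: "n \<ge> 2" and a: "a \<in> hops_from n m"
  shows "psize n (partition_of_weight n (hop n m a)) + n * a (n - 1)
    = psize n (partition_of_weight n m) + (\<Sum>j=1..n. a j)"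
proof -
  have "(\<Sum>j<n. tail_sum n (hop n m a) j + a (n - 1)) = (\<Sum>j<n. tail_sum n m j + a (prev_col n (Suc j)))"
    by (rule sum.cong) (use tail_sum_hop[OF n a] in auto)
  moreover have "(\<Sum>j<n. a (prev_col n (Suc j))) = (\<Sum>j=1..n. a j)"
    using n by (intro sum.reindex_bij_betw bij_prev_col_Suc) auto
  ultimately show ?thesis
    using n by (simp add: sum.distrib sum_tail_sum)
qed

text \<open>Walkers at different sites hop independently, so the hops form a product of intervals;
  its factors are listed in the order of the alternant columns.\<close>

lemma sum_hops_from:
  fixes g :: "(nat \<Rightarrow> nat) \<Rightarrow> 'a::comm_monoid_add"
  assumes n: "n \<ge> 1"
  shows "(\<Sum>a\<in>hops_from n m. g (\<lambda>j\<in>{..<n}. a (prev_col n (Suc j))))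
    = (\<Sum>b\<in>PiE {..<n} (\<lambda>j. {..m (prev_col n (Suc j))}). g b)"
proof -
  define q where "q j = prev_col n (Suc j)" for j
  define r where "r t = (if t = n then 0 else t)" for t :: nat
  have q: "q j \<in> {1..n}" "r (q j) = j" if "j < n" for j
    using that by (auto simp: q_def r_def prev_col_def)
  have r: "r t < n" "q (r t) = t" if "t \<in> {1..n}" for t
    using that by (auto simp: q_def r_def prev_col_def)
  have "(\<Sum>a\<in>hops_from n m. g (\<lambda>j\<in>{..<n}. a (q j))) = (\<Sum>b\<in>PiE {..<n} (\<lambda>j. {..m (q j)}). g b)"
  proof (rule sum.reindex_bij_witness[of _ "\<lambda>b t. if t \<in> {1..n} then b (r t) else 0"
        "\<lambda>a. \<lambda>j\<in>{..<n}. a (q j)"])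
    fix a assume a: "a \<in> hops_from n m"
    then have a0: "a t = 0" if "t \<notin> {1..n}" for t using that by (simp add: hops_from_def)
    have le: "a t \<le> m t" if "t \<in> {1..n}" for t using a that by (simp add: hops_from_def)
    show "(\<lambda>t. if t \<in> {1..n} then (\<lambda>j\<in>{..<n}. a (q j)) (r t) else 0) = a"
    proof
      fix t
      show "(if t \<in> {1..n} then (\<lambda>j\<in>{..<n}. a (q j)) (r t) else 0) = a t"
        using a0[of t] r[of t] by (cases "t \<in> {1..n}") (simp_all del: atLeastAtMost_iff)
    qed
    show "(\<lambda>j\<in>{..<n}. a (q j)) \<in> PiE {..<n} (\<lambda>j. {..m (q j)})"
      using le[OF q(1)] by (simp add: restrict_PiE_iff)
  next
    fix b assume b: "b \<in> PiE {..<n} (\<lambda>j. {..m (q j)})"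
    show "(\<lambda>j\<in>{..<n}. (\<lambda>t. if t \<in> {1..n} then b (r t) else 0) (q j)) = b"
    proof (rule extensionalityI[of _ "{..<n}"])
      show "b \<in> extensional {..<n}" using b by (simp add: PiE_def)
      fix j assume "j \<in> {..<n}"
      then show "(\<lambda>j\<in>{..<n}. (\<lambda>t. if t \<in> {1..n} then b (r t) else 0) (q j)) j = b j"
        using q[of j] by simp
    qed simp
    have "b (r t) \<le> m t" if "t \<in> {1..n}" for t
      using PiE_mem[OF b, of "r t"] r[OF that] by simp
    then show "(\<lambda>t. if t \<in> {1..n} then b (r t) else 0) \<in> hops_from n m"
      by (simp add: hops_from_def)
  qed simp
  then show ?thesis by (simp add: q_def)
qed

section \<open>Alternants under the one-row transfer matrix\<close>

text \<open>When the \<open>y i\<close> multiply to 1, full columns can be added or removed without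
  changing the alternant.\<close>

lemma alternant_shift:
  "alternant n y (\<lambda>j. L j + s) = (\<Prod>i<n. y i) ^ s * alternant n y L"
proof -
  have "alternant n y (\<lambda>j. L j + s) = det (mat n n (\<lambda>(i,j). y i ^ s * y i ^ L j))"
    by (simp add: alternant_def power_add mult.commute)
  also have "\<dots> = (\<Prod>i<n. y i ^ s) * alternant n y L"
    unfolding alternant_def by (rule det_scale_rows)
  finally show ?thesis by (simp only: prod_power_distrib)
qed

text \<open>Summing over all hops turns the columns of the alternant into geometric sums, which after
  clearing denominators are cyclic differences of the original columns.\<close>

lemma transfer_alternant:
  fixes y :: "nat \<Rightarrow> 'a::idom"
  assumes n: "n \<ge> 2" and m: "m \<in> level_weights n k"
    and y1: "(\<Prod>i<n. y i) = 1" and yN: "\<And>i. i < n \<Longrightarrow> y i ^ (k + n) = c" and x: "x \<noteq> 0"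
  shows "(\<Prod>i<n. 1 - x * y i) * (\<Sum>a\<in>hops_from n m.
      x ^ (\<Sum>j=1..n. a j) * alternant n y (shifted_part n (hop n m a)))
    = (1 - c * x ^ (k + n)) * alternant n y (shifted_part n m)"
proof -
  define L where "L = shifted_part n m"
  define q where "q j = prev_col n (Suc j)" for j
  have bq: "bij_betw q {..<n} {1..n}" unfolding q_def using n by (intro bij_prev_col_Suc) auto
  \<comment> \<open>Adding \<open>a (n - 1)\<close> to all exponents is free since the
    \<open>y i\<close> multiply to 1, and it undoes the column removal in
    \<open>tail_sum_hop\<close>. Each column then depends on its own \<open>a (q j)\<close>
    only.\<close>
  have summand: "x ^ (\<Sum>j=1..n. a j) * alternant n y (shifted_part n (hop n m a))
      = det (mat n n (\<lambda>(i,j). x ^ (a (q j)) * y i ^ (L j + a (q j))))" if a: "a \<in> hops_from n m" for a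
  proof -
    have "alternant n y (shifted_part n (hop n m a)) = alternant n y (\<lambda>j. shifted_part n (hop n m a) j + a (n - 1))"
      by (simp add: alternant_shift y1)
    also have "\<dots> = alternant n y (\<lambda>j. L j + a (q j))"
      unfolding alternant_def
    proof (intro arg_cong[where f = det] eq_matI)
      fix i j assume "i < dim_row (mat n n (\<lambda>(i,j). y i ^ (L j + a (q j))))"
        "j < dim_col (mat n n (\<lambda>(i,j). y i ^ (L j + a (q j))))"
      then show "mat n n (\<lambda>(i,j). y i ^ (shifted_part n (hop n m a) j + a (n - 1))) $$ (i,j)
          = mat n n (\<lambda>(i,j). y i ^ (L j + a (q j))) $$ (i,j)"
        using tail_sum_hop[OF n a, of j] by (simp add: L_def shifted_part_def q_def add_ac)
    qed auto
    finally have 1: "alternant n y (shifted_part n (hop n m a)) = alternant n y (\<lambda>j. L j + a (q j))" .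
    have 2: "(\<Sum>j=1..n. a j) = (\<Sum>j<n. a (q j))"
      by (rule sum.reindex_bij_betw[OF bq, symmetric])
    show ?thesis unfolding 1 2 by (simp add: det_scale_cols alternant_def power_sum)
  qed
  have "(\<Sum>a\<in>hops_from n m. x ^ (\<Sum>j=1..n. a j) * alternant n y (shifted_part n (hop n m a)))
    = (\<Sum>a\<in>hops_from n m. det (mat n n (\<lambda>(i,j). x ^ ((\<lambda>j\<in>{..<n}. a (prev_col n (Suc j))) j)
        * y i ^ (L j + (\<lambda>j\<in>{..<n}. a (prev_col n (Suc j))) j))))"
    by (rule sum.cong[OF refl], subst summand)
      (auto intro!: arg_cong[where f = det] eq_matI simp: q_def)
  also have "\<dots> = (\<Sum>b\<in>PiE {..<n} (\<lambda>j. {..m (q j)}). det (mat n n (\<lambda>(i,j). x ^ b j * y i ^ (L j + b j))))"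
    unfolding q_def using n by (intro sum_hops_from) auto
  also have "\<dots> = det (mat n n (\<lambda>(i,j). \<Sum>t\<le>m (q j). x ^ t * y i ^ (L j + t)))"
    by (rule det_sum_entries) simp
  finally have S: "(\<Sum>a\<in>hops_from n m. x ^ (\<Sum>j=1..n. a j) * alternant n y (shifted_part n (hop n m a)))
    = det (mat n n (\<lambda>(i,j). \<Sum>t\<le>m (q j). x ^ t * y i ^ (L j + t)))" (is "?S = ?D") .
  \<comment> \<open>The exponent just past the end of the geometric sum is
    \<open>L j + m (q j) + 1 = L (j - 1)\<close>, that of the preceding column. For
    \<open>j = 0\<close> it is \<open>k + n\<close>, and \<open>y i ^ (k + n) = c\<close> leads back
    to column \<open>n - 1\<close>, whose exponent is 0. The factor \<open>x ^ L j\<close> makes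
    \<open>x\<close> and \<open>y i\<close> occur only as a product.\<close>
  have geo: "x ^ L j * ((1 - x * y i) * (\<Sum>t\<le>m (q j). x ^ t * y i ^ (L j + t)))
    = (x * y i) ^ L j - (if j = 0 then c * x ^ (k + n) * (x * y i) ^ L (n - 1) else (x * y i) ^ L (j - 1))"
    if ij: "i < n" "j < n" for i j
  proof -
    have "x ^ L j * ((1 - x * y i) * (\<Sum>t\<le>m (q j). x ^ t * y i ^ (L j + t)))
      = (x * y i) ^ L j * ((1 - x * y i) * (\<Sum>t\<le>m (q j). (x * y i) ^ t))"
      by (simp add: power_add power_mult_distrib sum_distrib_left mult_ac)
    also have "\<dots> = (x * y i) ^ L j * (1 - (x * y i) ^ Suc (m (q j)))"
      by (simp only: sum_gp_basic)
    also have "\<dots> = (x * y i) ^ L j - (x * y i) ^ (L j + Suc (m (q j)))"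
      by (simp add: right_diff_distrib power_add)
    also have "(x * y i) ^ (L j + Suc (m (q j)))
      = (if j = 0 then c * x ^ (k + n) * (x * y i) ^ L (n - 1) else (x * y i) ^ L (j - 1))"
    proof (cases j)
      case 0
      have "L 0 + Suc (m n) = k + n"
        using tail_sum_0[of n m k] n m by (simp add: L_def shifted_part_def)
      moreover have "L (n - 1) = 0" by (simp add: L_def shifted_part_def)
      ultimately show ?thesis using 0 yN[OF ij(1)] by (simp add: q_def prev_col_def power_mult_distrib mult.commute)
    next
      case (Suc j')
      then have "L j + Suc (m (q j)) = L (j - 1)"
        using ij tail_sum_Suc[of j' n m] by (simp add: L_def shifted_part_def q_def prev_col_def)
      then show ?thesis using Suc by simp
    qed
    finally show ?thesis .
  qed
  have "(\<Prod>j<n. x ^ L j) * ((\<Prod>i<n. 1 - x * y i) * ?S)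
    = det (mat n n (\<lambda>(i,j). x ^ L j * ((1 - x * y i) * (\<Sum>t\<le>m (q j). x ^ t * y i ^ (L j + t)))))"
    unfolding S by (simp add: det_scale_rows det_scale_cols)
  also have "\<dots> = det (mat n n (\<lambda>(i,j). (x * y i) ^ L j
      - (if j = 0 then c * x ^ (k + n) * (x * y i) ^ L (n - 1) else (x * y i) ^ L (j - 1))))"
    by (intro arg_cong[where f = det] eq_matI) (simp_all add: geo)
  also have "\<dots> = (1 - c * x ^ (k + n)) * det (mat n n (\<lambda>(i,j). (x * y i) ^ L j))"
    using n by (intro det_cyclic_differences) auto
  also have "\<dots> = (\<Prod>j<n. x ^ L j) * ((1 - c * x ^ (k + n)) * alternant n y L)"
    by (simp add: power_mult_distrib det_scale_cols alternant_def)
  finally show ?thesis using x by (simp add: L_def)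
qed

section \<open>Paths through several rows\<close>

text \<open>Configurations with \<open>R\<close> rows and a free endpoint, suited to induction on
  \<open>R\<close>. Hop row 0 and all rows beyond \<open>R\<close> are set to zero, so that equality
  of functions is equality of paths.\<close>

definition paths :: "nat \<Rightarrow> nat \<Rightarrow> (nat \<Rightarrow> nat) \<Rightarrow> config set" where
  "paths n R \<mu> = {(m, a). m 0 = \<mu> \<and> a 0 = (\<lambda>_. 0) \<and> (\<forall>i>R. m i = (\<lambda>_. 0) \<and> a i = (\<lambda>_. 0)) \<and>
     (\<forall>i<R. a (Suc i) \<in> hops_from n (m i) \<and> m (Suc i) = hop n (m i) (a (Suc i)))}"

definition hop_count :: "nat \<Rightarrow> nat \<Rightarrow> config \<Rightarrow> nat" where
  "hop_count n R c = (\<Sum>i=1..R. \<Sum>j=1..n. snd c i j)"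

lemma paths_0: "paths n 0 \<mu> = {((\<lambda>_ _. 0)(0 := \<mu>), \<lambda>_ _. 0)}"
proof (intro equalityI subsetI)
  fix c assume c: "c \<in> paths n 0 \<mu>"
  obtain m a where ma: "c = (m, a)" by (cases c)
  have "m i = ((\<lambda>_ _. 0)(0 := \<mu>)) i" "a i = (\<lambda>_. 0)" for i
    using c by (cases i; simp add: ma paths_def)+
  then show "c \<in> {((\<lambda>_ _. 0)(0 := \<mu>), \<lambda>_ _. 0)}" by (auto simp: ma)
qed (simp add: paths_def)

lemma paths_Suc:
  "paths n (Suc R) \<mu> = (\<lambda>(c, b). ((fst c)(Suc R := hop n (fst c R) b), (snd c)(Suc R := b)))
     ` (SIGMA c:paths n R \<mu>. hops_from n (fst c R))" (is "?L = ?f ` ?S")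
proof (intro equalityI subsetI)
  fix c assume c: "c \<in> ?L"
  obtain m a where ma: "c = (m, a)" by (cases c)
  define c' where "c' = (m(Suc R := (\<lambda>_. 0)), a(Suc R := (\<lambda>_. 0)))"
  have "c' \<in> paths n R \<mu>"
    using c by (simp add: ma c'_def paths_def)
  moreover have "a (Suc R) \<in> hops_from n (m R)" "m (Suc R) = hop n (m R) (a (Suc R))"
    using c by (simp_all add: ma paths_def)
  ultimately show "c \<in> ?f ` ?S"
    by (intro image_eqI[of _ _ "(c', a (Suc R))"]) (simp_all add: c'_def ma fun_upd_idem)
next
  fix c assume "c \<in> ?f ` ?S"
  then obtain m a b where c: "c = (m(Suc R := hop n (m R) b), a(Suc R := b))"
    and ma: "(m, a) \<in> paths n R \<mu>" and b: "b \<in> hops_from n (m R)" by auto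
  show "c \<in> ?L"
    using ma b by (simp add: c paths_def less_Suc_eq)
qed

lemma inj_paths_Suc:
  "inj_on (\<lambda>(c, b). ((fst c)(Suc R := hop n (fst c R) b), (snd c)(Suc R := b)))
     (SIGMA c:paths n R \<mu>. hops_from n (fst c R))"
proof (rule inj_onI, clarsimp)
  fix m a b m' a' b'
  assume mem: "(m, a) \<in> paths n R \<mu>" "(m', a') \<in> paths n R \<mu>"
    and eq: "m(Suc R := hop n (m R) b) = m'(Suc R := hop n (m' R) b')" "a(Suc R := b) = a'(Suc R := b')"
  \<comment> \<open>Row \<open>R + 1\<close> is zero in both paths, so overwriting it destroys no
    information.\<close>
  have z: "m (Suc R) = m' (Suc R)" "a (Suc R) = a' (Suc R)"
    using mem by (simp_all add: paths_def)
  have "m i = m' i" "a i = a' i" for i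
    using fun_cong[OF eq(1), of i] fun_cong[OF eq(2), of i] z by (cases "i = Suc R"; simp)+
  moreover have "b = b'" using fun_cong[OF eq(2), of "Suc R"] by simp
  ultimately show "m = m' \<and> a = a' \<and> b = b'" by auto
qed

lemma finite_paths: "finite (paths n R \<mu>)"
  by (induction R) (auto simp: paths_0 paths_Suc finite_hops_from)

lemma paths_level:
  assumes n: "n \<ge> 1" and \<mu>: "\<mu> \<in> level_weights n k" and c: "c \<in> paths n R \<mu>" and i: "i \<le> R"
  shows "fst c i \<in> level_weights n k"
  using i
proof (induction i)
  case 0
  then show ?case using c \<mu> by (auto simp: paths_def)
next
  case (Suc i)
  have "snd c (Suc i) \<in> hops_from n (fst c i)" "fst c (Suc i) = hop n (fst c i) (snd c (Suc i))"
    using c Suc.prems by (auto simp: paths_def)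
  then show ?case using hop_in_level_weights[OF n] Suc by simp
qed

lemma sum_paths_Suc:
  "(\<Sum>c\<in>paths n (Suc R) \<mu>. F (fst c (Suc R)) (hop_count n (Suc R) c))
    = (\<Sum>c\<in>paths n R \<mu>. \<Sum>b\<in>hops_from n (fst c R).
         F (hop n (fst c R) b) (hop_count n R c + (\<Sum>j=1..n. b j)))"
proof -
  have "(\<Sum>c\<in>paths n (Suc R) \<mu>. F (fst c (Suc R)) (hop_count n (Suc R) c))
    = (\<Sum>(c, b)\<in>(SIGMA c:paths n R \<mu>. hops_from n (fst c R)).
         F (hop n (fst c R) b) (hop_count n R c + (\<Sum>j=1..n. b j)))"
    unfolding paths_Suc by (subst sum.reindex[OF inj_paths_Suc]) (auto intro!: sum.cong simp: hop_count_def)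
  then show ?thesis
    by (simp add: sum.Sigma finite_paths finite_hops_from)
qed

text \<open>The level is preserved, so the one-row identity applies in every row and contributes the
  same scalar factors each time.\<close>

lemma transfer_alternant_paths:
  fixes y :: "nat \<Rightarrow> 'a::idom"
  assumes n: "n \<ge> 2" and \<mu>: "\<mu> \<in> level_weights n k"
    and y1: "(\<Prod>i<n. y i) = 1" and yN: "\<And>i. i < n \<Longrightarrow> y i ^ (k + n) = c" and x: "x \<noteq> 0"
  shows "(\<Prod>i<n. 1 - x * y i) ^ R * (\<Sum>c\<in>paths n R \<mu>.
      x ^ hop_count n R c * alternant n y (shifted_part n (fst c R)))
    = (1 - c * x ^ (k + n)) ^ R * alternant n y (shifted_part n \<mu>)"
proof (induction R)
  case 0
  show ?case by (simp add: paths_0 hop_count_def)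
next
  case (Suc R)
  let ?D = "\<Prod>i<n. 1 - x * y i" and ?E = "1 - c * x ^ (k + n)"
  have row: "?D * (\<Sum>b\<in>hops_from n (fst p R). x ^ (\<Sum>j=1..n. b j) * alternant n y (shifted_part n (hop n (fst p R) b)))
      = ?E * alternant n y (shifted_part n (fst p R))" if "p \<in> paths n R \<mu>" for p
    using n paths_level[OF _ \<mu> that, of R] by (intro transfer_alternant y1 yN x) auto
  have "?D ^ Suc R * (\<Sum>c\<in>paths n (Suc R) \<mu>. x ^ hop_count n (Suc R) c * alternant n y (shifted_part n (fst c (Suc R))))
    = ?D ^ R * (\<Sum>p\<in>paths n R \<mu>. x ^ hop_count n R p *
        (?D * (\<Sum>b\<in>hops_from n (fst p R). x ^ (\<Sum>j=1..n. b j) * alternant n y (shifted_part n (hop n (fst p R) b)))))"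
    by (subst sum_paths_Suc[of "\<lambda>m h. x ^ h * alternant n y (shifted_part n m)"])
      (simp add: power_add sum_distrib_left mult_ac)
  also have "\<dots> = ?D ^ R * (\<Sum>p\<in>paths n R \<mu>. x ^ hop_count n R p * (?E * alternant n y (shifted_part n (fst p R))))"
    by (rule arg_cong[where f = "(*) (?D ^ R)"], rule sum.cong[OF refl]) (simp only: row)
  also have "\<dots> = ?E * (?D ^ R * (\<Sum>p\<in>paths n R \<mu>. x ^ hop_count n R p * alternant n y (shifted_part n (fst p R))))"
    by (simp add: sum_distrib_left mult_ac)
  finally show ?case unfolding Suc.IH by (simp add: mult_ac)
qed

text \<open>The eigenvalue on the right-hand side of the previous lemma does not depend on the starting
  weight, so it cancels when two starting weights are compared.\<close>

lemma alternant_paths_exchange: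
  fixes y :: "nat \<Rightarrow> complex"
  assumes n: "n \<ge> 2" and \<mu>: "\<mu> \<in> level_weights n k" and \<kappa>: "\<kappa> \<in> level_weights n k"
    and y1: "(\<Prod>i<n. y i) = 1" and yN: "\<And>i. i < n \<Longrightarrow> y i ^ (k + n) = c"
  shows "alternant n y (shifted_part n \<kappa>) *
      (\<Sum>p | p \<in> paths n R \<mu> \<and> hop_count n R p = A. alternant n y (shifted_part n (fst p R)))
    = alternant n y (shifted_part n \<mu>) *
      (\<Sum>p | p \<in> paths n R \<kappa> \<and> hop_count n R p = A. alternant n y (shifted_part n (fst p R)))"
proof -
  \<comment> \<open>Generating polynomial in the hop variable; the claim compares two coefficients
    at \<open>A\<close>.\<close>
  define G where "G \<tau> \<mu> = (\<Sum>p\<in>paths n R \<mu>. monom (alternant n y (shifted_part n \<tau>)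
      * alternant n y (shifted_part n (fst p R))) (hop_count n R p))" for \<tau> \<mu>
  have pG: "poly (G \<tau> \<mu>) x = alternant n y (shifted_part n \<tau>) *
      (\<Sum>p\<in>paths n R \<mu>. x ^ hop_count n R p * alternant n y (shifted_part n (fst p R)))" for \<tau> \<mu> x
    by (simp add: G_def poly_sum poly_monom sum_distrib_left mult_ac)
  have cG: "coeff (G \<tau> \<mu>) A = alternant n y (shifted_part n \<tau>) *
      (\<Sum>p | p \<in> paths n R \<mu> \<and> hop_count n R p = A. alternant n y (shifted_part n (fst p R)))" for \<tau> \<mu>
    by (auto simp: G_def coeff_sum sum_distrib_left sum.inter_filter finite_paths intro!: sum.cong)
  \<comment> \<open>The value 0 and those at which the factor to be cancelled could vanish. They are
    finitely many, so the difference polynomial has infinitely many roots.\<close>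
  define Z where "Z = insert 0 ((\<lambda>i. 1 / y i) ` {..<n})"
  have zero: "poly (G \<kappa> \<mu> - G \<mu> \<kappa>) x = 0" if x: "x \<notin> Z" for x
  proof -
    have x0: "x \<noteq> 0" using x by (simp add: Z_def)
    let ?D = "\<Prod>i<n. 1 - x * y i"
    have "?D \<noteq> 0"
    proof
      assume "?D = 0"
      then obtain i where i: "i < n" "x * y i = 1" by auto
      then have "x = 1 / y i" by (cases "y i = 0") (auto simp: field_simps)
      then show False using i x by (auto simp: Z_def)
    qed
    have "?D ^ R * poly (G \<kappa> \<mu>) x = ?D ^ R * poly (G \<mu> \<kappa>) x"
      using transfer_alternant_paths[OF n \<mu> y1 yN x0, of R] transfer_alternant_paths[OF n \<kappa> y1 yN x0, of R]
      unfolding pG by (simp add: mult_ac)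
    then show ?thesis using \<open>?D \<noteq> 0\<close> by simp
  qed
  have "G \<kappa> \<mu> - G \<mu> \<kappa> = 0"
  proof (rule ccontr)
    assume "G \<kappa> \<mu> - G \<mu> \<kappa> \<noteq> 0"
    then have "finite {x. poly (G \<kappa> \<mu> - G \<mu> \<kappa>) x = 0}" by (rule poly_roots_finite)
    moreover have "UNIV = {x. poly (G \<kappa> \<mu> - G \<mu> \<kappa>) x = 0} \<union> Z" using zero by auto
    moreover have "finite Z" by (simp add: Z_def)
    ultimately have "finite (UNIV :: complex set)" by (metis finite_Un)
    then show False using infinite_UNIV_char_0 by blast
  qed
  then have "coeff (G \<kappa> \<mu>) A = coeff (G \<mu> \<kappa>) A" by simp
  then show ?thesis by (simp only: cG)
qed

section \<open>Configurations from the vacuum\<close>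

definition vacuum :: "nat \<Rightarrow> nat \<Rightarrow> nat \<Rightarrow> nat" where
  "vacuum n k = (\<lambda>_. 0)(n := k)"

lemma vacuum_in: "n \<ge> 1 \<Longrightarrow> vacuum n k \<in> level_weights n k"
  by (auto simp: vacuum_def level_weights_def sum.delta')

text \<open>For \<open>R < n\<close> these are the weights whose partition has at most
  \<open>R\<close> parts; \<open>R\<close> rows lead from the vacuum into this set.\<close>

definition short_weights :: "nat \<Rightarrow> nat \<Rightarrow> nat \<Rightarrow> (nat \<Rightarrow> nat) set" where
  "short_weights n k R = {m \<in> level_weights n k. \<forall>i. R < i \<longrightarrow> i < n \<longrightarrow> m i = 0}"

text \<open>The dimension of the irreducible \<open>GL\<^bsub>R\<^esub>\<close>-module indexed by the partition of \<open>m\<close>.\<close>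

definition gl_dim :: "nat \<Rightarrow> nat \<Rightarrow> (nat \<Rightarrow> nat) \<Rightarrow> complex" where
  "gl_dim n R m = det (mat R R (\<lambda>(i,j). of_nat (tail_sum n m j + (R - 1 - j) choose (R - 1 - i))))"

lemma finite_short_weights: "finite (short_weights n k R)"
  unfolding short_weights_def using finite_level_weights by simp

section \<open>Branching and Gelfand-Tsetlin patterns\<close>

text \<open>Hockey-stick identity without subtraction; it does for binomials what the geometric sum
  does for alternants.\<close>

lemma sum_choose_interval:
  "(\<Sum>t\<le>M. (L + t) choose d) + (L choose Suc d) = (L + Suc M) choose Suc d"
  by (induction M) simp_all

text \<open>A hop from \<open>m\<close> to \<open>m'\<close> is recovered from \<open>m'\<close> and the numbers \<open>g j\<close> of walkers at
  site \<open>j + 1\<close> that stay put.\<close>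

definition stayers :: "nat \<Rightarrow> (nat \<Rightarrow> nat) \<Rightarrow> (nat \<Rightarrow> nat) \<Rightarrow> nat \<Rightarrow> nat" where
  "stayers R m a = (\<lambda>j\<in>{..<R}. m (Suc j) - a (Suc j))"

definition arrivals :: "nat \<Rightarrow> (nat \<Rightarrow> nat) \<Rightarrow> (nat \<Rightarrow> nat) \<Rightarrow> nat \<Rightarrow> nat" where
  "arrivals R m' g t = m' t - (if t \<in> {1..R} then g (t - 1) else 0)"

text \<open>Walkers arriving at site \<open>t + 1\<close> have left site \<open>t\<close>, and those
  arriving at site 1 have left site \<open>n\<close>.\<close>

definition unhop_hops :: "nat \<Rightarrow> nat \<Rightarrow> (nat \<Rightarrow> nat) \<Rightarrow> (nat \<Rightarrow> nat) \<Rightarrow> nat \<Rightarrow> nat" where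
  "unhop_hops n R m' g t = (if t \<in> {1..R} then arrivals R m' g (Suc t) else if t = n then arrivals R m' g 1 else 0)"

text \<open>For short weights with \<open>R + 1 < n\<close> nobody enters site \<open>n\<close>, so
  all \<open>m' n\<close> walkers found there have stayed.\<close>

definition unhop :: "nat \<Rightarrow> nat \<Rightarrow> (nat \<Rightarrow> nat) \<Rightarrow> (nat \<Rightarrow> nat) \<Rightarrow> nat \<Rightarrow> nat" where
  "unhop n R m' g t = (if t \<in> {1..R} then g (t - 1) else if t = n then m' n else 0) + unhop_hops n R m' g t"

text \<open>The front of the walkers advances by at most one site per row and site
  \<open>n - 1\<close> is still empty, so no column is completed.\<close>

lemma hop_short:
  assumes R: "Suc R < n" and m: "m \<in> short_weights n k R" and a: "a \<in> hops_from n m"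
  shows "hop n m a \<in> short_weights n k (Suc R)" "a (n - 1) = 0"
proof -
  have le: "a t \<le> m t" if "t \<in> {1..n}" for t using a that by (simp add: hops_from_def)
  have z: "m t = 0" if "R < t" "t < n" for t using m that by (simp add: short_weights_def)
  have az: "a t = 0" if "R < t" "t < n" for t using le[of t] z[of t] that by simp
  show "a (n - 1) = 0" using R by (intro az) auto
  have "hop n m a t = 0" if "Suc R < t" "t < n" for t
    using that z[of t] az[of "t - 1"] az[of t] by (simp add: hop_def prev_col_def)
  moreover have "hop n m a \<in> level_weights n k"
    using m R by (intro hop_in_level_weights a) (auto simp: short_weights_def)
  ultimately show "hop n m a \<in> short_weights n k (Suc R)" by (simp add: short_weights_def)
qed

text \<open>One half of a bijection between sources with a hop and targets with stayers, by which
  sums over hops are rearranged by target.\<close>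

lemma unhop_hop:
  assumes R: "Suc R < n" and m: "m \<in> short_weights n k R" and a: "a \<in> hops_from n m"
  shows "stayers R m a \<in> PiE {..<R} (\<lambda>j. {..hop n m a (Suc j)})"
    "unhop n R (hop n m a) (stayers R m a) = m"
    "unhop_hops n R (hop n m a) (stayers R m a) = a"
proof -
  have le: "a t \<le> m t" if "t \<in> {1..n}" for t using a that by (simp add: hops_from_def)
  have z: "m t = 0" if "R < t" "t < n" for t using m that by (simp add: short_weights_def)
  have mz: "m t = 0" if "t \<notin> {1..n}" for t using m that by (simp add: short_weights_def level_weights_def)
  have az: "a t = 0" if "t \<notin> {1..R}" "t \<noteq> n" for t
  proof (cases "t \<in> {1..n}")
    case True
    then show ?thesis using le[of t] z[of t] that by auto
  qed (use a in \<open>simp add: hops_from_def\<close>)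
  have s: "stayers R m a j = m (Suc j) - a (Suc j)" if "j < R" for j using that by (simp add: stayers_def)
  \<comment> \<open>For \<open>t = R\<close> the site \<open>R + 1\<close> is empty in
    \<open>m\<close>, so all walkers found there after the hop are arrivals.\<close>
  have arr: "arrivals R (hop n m a) (stayers R m a) (Suc t) = a (if t = 0 then n else t)" if "t \<le> R" for t
  proof (cases "t < R")
    case True
    then show ?thesis using R by (simp add: arrivals_def s hop_def prev_col_def)
  next
    case False
    then have "t = R" using that by simp
    then show ?thesis using R z[of "Suc R"] by (simp add: arrivals_def hop_def prev_col_def)
  qed
  have hops: "unhop_hops n R (hop n m a) (stayers R m a) t = a t" for t
    using arr[of t] arr[of 0] az[of t] by (auto simp: unhop_hops_def)
  then show "unhop_hops n R (hop n m a) (stayers R m a) = a" by (rule ext)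
  have "a (n - 1) = 0" using hop_short[OF R m a] by simp
  then have hn: "hop n m a n = m n - a n" using R by (simp add: hop_def prev_col_def)
  have "unhop n R (hop n m a) (stayers R m a) t = m t" for t
  proof -
    consider "t \<in> {1..R}" | "t = n" | "t \<notin> {1..R}" "t \<noteq> n" by blast
    then show ?thesis
    proof cases
      case 1
      then have "t - 1 < R" "t \<in> {1..n}" using R by auto
      then show ?thesis using 1 s[of "t - 1"] le[of t] unfolding unhop_def hops by simp
    next
      case 2
      then show ?thesis using hn le[of n] R unfolding unhop_def hops by simp
    next
      case 3
      then have "m t = 0" using mz[of t] z[of t] by (cases "t \<in> {1..n}") auto
      then show ?thesis using 3 az[OF 3] unfolding unhop_def hops by auto
    qed
  qed
  then show "unhop n R (hop n m a) (stayers R m a) = m" by (rule ext)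
  show "stayers R m a \<in> PiE {..<R} (\<lambda>j. {..hop n m a (Suc j)})"
    using R by (auto simp: stayers_def hop_def)
qed

text \<open>The other half. The single constraint \<open>g j \<le> m' (Suc j)\<close> is the
  interlacing condition between successive rows of a Gelfand-Tsetlin pattern.\<close>

lemma hop_unhop:
  assumes R: "Suc R < n" and m': "m' \<in> short_weights n k (Suc R)"
    and g: "g \<in> PiE {..<R} (\<lambda>j. {..m' (Suc j)})"
  shows "unhop n R m' g \<in> short_weights n k R" "unhop_hops n R m' g \<in> hops_from n (unhop n R m' g)"
    "hop n (unhop n R m' g) (unhop_hops n R m' g) = m'"
    "stayers R (unhop n R m' g) (unhop_hops n R m' g) = g"
proof -
  let ?m = "unhop n R m' g" and ?a = "unhop_hops n R m' g"
  have gl: "g j \<le> m' (Suc j)" if "j < R" for j using g that by auto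
  have z: "m' t = 0" if "Suc R < t" "t < n" for t using m' that by (simp add: short_weights_def)
  have mz: "m' t = 0" if "t \<notin> {1..n}" for t using m' that by (simp add: short_weights_def level_weights_def)
  show hf: "?a \<in> hops_from n ?m"
    using R by (auto simp: hops_from_def unhop_def unhop_hops_def)
  have sub: "?m t - ?a t = (if t \<in> {1..R} then g (t - 1) else if t = n then m' n else 0)" for t
    by (simp add: unhop_def)
  have arr: "?a (prev_col n t) = (if t \<in> {1..Suc R} then arrivals R m' g t else 0)" if "t \<in> {1..n}" for t
    using that R by (auto simp: unhop_hops_def prev_col_def)
  have "hop n ?m ?a t = m' t" for t
  proof (cases "t \<in> {1..n}")
    case t: True
    consider "t \<in> {1..R}" | "t = Suc R" | "Suc R < t" "t < n" | "t = n" using t by force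
    then show ?thesis
    proof cases
      case 1
      then have "t - 1 < R" by auto
      then show ?thesis using 1 t arr[OF t] gl[of "t - 1"] by (simp add: hop_def sub arrivals_def)
    next
      case 2
      then show ?thesis using t R arr[OF t] by (simp add: hop_def sub arrivals_def)
    next
      case 3
      then show ?thesis using t arr[OF t] z[OF 3] by (simp add: hop_def sub)
    next
      case 4
      then show ?thesis using t R arr[OF t] by (simp add: hop_def sub)
    qed
  next
    case False
    then show ?thesis using mz[OF False] by (simp add: hop_def del: atLeastAtMost_iff)
  qed
  then show h: "hop n ?m ?a = m'" by (rule ext)
  have "(\<Sum>j=1..n. ?m j) = k"
    using sum_hop[OF _ hf] m' R by (simp add: h short_weights_def level_weights_def)
  then show "?m \<in> short_weights n k R"
    using R by (auto simp: short_weights_def level_weights_def unhop_def unhop_hops_def)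
  show "stayers R ?m ?a = g"
  proof (rule extensionalityI[of _ "{..<R}"])
    show "g \<in> extensional {..<R}" using g by (simp add: PiE_def)
  qed (auto simp: stayers_def sub)
qed

text \<open>Branching from rank \<open>R + 1\<close> to rank \<open>R\<close>: the columns are
  summed independently, and the hockey-stick identity gives differences of adjacent columns of a
  determinant one size larger, whose last row consists of \<open>l j choose 0 = 1\<close>.\<close>

lemma gl_dim_branching:
  assumes R: "Suc R < n" and m': "m' \<in> short_weights n k (Suc R)"
  shows "(\<Sum>g\<in>PiE {..<R} (\<lambda>j. {..m' (Suc j)}). gl_dim n R (unhop n R m' g)) = gl_dim n (Suc R) m'"
proof -
  define l where "l j = tail_sum n m' j + (R - j)" for j
  have lSuc: "l j = l (Suc j) + Suc (m' (Suc j))" if "j < R" for j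
    using that R tail_sum_Suc[of j n m'] by (simp add: l_def)
  \<comment> \<open>Part \<open>j + 1\<close> of the source is part \<open>j + 2\<close> of the
    target plus \<open>g j\<close>, hence lies between two consecutive parts of the target.\<close>
  have tail: "tail_sum n (unhop n R m' g) j + (R - 1 - j) = l (Suc j) + g j"
    if g: "g \<in> PiE {..<R} (\<lambda>j. {..m' (Suc j)})" and j: "j < R" for g j
  proof -
    let ?m = "unhop n R m' g" and ?a = "unhop_hops n R m' g"
    note U = hop_unhop[OF R m' g]
    have "tail_sum n m' (Suc j) = tail_sum n ?m (Suc j) + ?a (Suc j)"
      using tail_sum_hop[OF _ U(2), of "Suc j"] U(3) hop_short(2)[OF R U(1,2)] R j by (simp add: prev_col_def)
    moreover have "?m (Suc j) = g j + ?a (Suc j)" using j by (simp add: unhop_def)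
    moreover have "tail_sum n ?m j = ?m (Suc j) + tail_sum n ?m (Suc j)"
      using j R by (intro tail_sum_Suc) auto
    ultimately show ?thesis by (simp add: l_def)
  qed
  have "(\<Sum>g\<in>PiE {..<R} (\<lambda>j. {..m' (Suc j)}). gl_dim n R (unhop n R m' g))
    = (\<Sum>g\<in>PiE {..<R} (\<lambda>j. {..m' (Suc j)}). det (mat R R (\<lambda>(i,j). of_nat (l (Suc j) + g j choose (R - 1 - i)))))"
    unfolding gl_dim_def by (intro sum.cong refl arg_cong[where f = det] eq_matI) (simp_all only: tail dim_row_mat dim_col_mat index_mat case_prod_conv)
  also have "\<dots> = det (mat R R (\<lambda>(i,j). \<Sum>t\<le>m' (Suc j). of_nat (l (Suc j) + t choose (R - 1 - i))))"
    by (rule det_sum_entries) simp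
  also have "\<dots> = det (mat R R (\<lambda>(i,j). of_nat (l j choose (R - i)) - of_nat (l (Suc j) choose (R - i))))"
  proof (intro arg_cong[where f = det] eq_matI)
    fix i j assume "i < dim_row (mat R R (\<lambda>(i,j). of_nat (l j choose (R - i)) - of_nat (l (Suc j) choose (R - i)) :: complex))"
      "j < dim_col (mat R R (\<lambda>(i,j). of_nat (l j choose (R - i)) - of_nat (l (Suc j) choose (R - i)) :: complex))"
    then have ij: "i < R" "j < R" by auto
    have "(\<Sum>t\<le>m' (Suc j). l (Suc j) + t choose (R - 1 - i)) + (l (Suc j) choose (R - i)) = l j choose (R - i)"
      using sum_choose_interval[of "l (Suc j)" "R - 1 - i" "m' (Suc j)"] ij lSuc[of j] by (simp add: Suc_diff_Suc)
    then have "(\<Sum>t\<le>m' (Suc j). of_nat (l (Suc j) + t choose (R - 1 - i))) + of_nat (l (Suc j) choose (R - i))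
        = (of_nat (l j choose (R - i)) :: complex)"
      by (simp flip: of_nat_sum of_nat_add)
    then show "mat R R (\<lambda>(i,j). \<Sum>t\<le>m' (Suc j). of_nat (l (Suc j) + t choose (R - 1 - i))) $$ (i,j)
      = mat R R (\<lambda>(i,j). of_nat (l j choose (R - i)) - of_nat (l (Suc j) choose (R - i)) :: complex) $$ (i,j)"
      using ij by (simp add: eq_diff_eq)
  qed auto
  also have "\<dots> = det (mat (Suc R) (Suc R) (\<lambda>(i,j). of_nat (l j choose (R - i))))"
    by (rule det_row_of_ones) simp
  finally show ?thesis by (simp add: gl_dim_def l_def)
qed

text \<open>Induction on the rows: no column is dropped, so the hops add up to the size of the
  partition, and the multiplicities follow the branching rule. With \<open>F\<close> arbitrary, the
  induction hypothesis can absorb the last row.\<close>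

lemma sum_paths_vacuum:
  fixes F :: "(nat \<Rightarrow> nat) \<Rightarrow> nat \<Rightarrow> complex"
  assumes "R < n"
  shows "(\<Sum>c\<in>paths n R (vacuum n k). F (fst c R) (hop_count n R c))
    = (\<Sum>m\<in>short_weights n k R. gl_dim n R m * F m (psize n (partition_of_weight n m)))"
  using assms
proof (induction R arbitrary: F)
  case 0
  have "m = vacuum n k" if "m \<in> short_weights n k 0" for m
  proof -
    have z: "m i = 0" if "i \<noteq> n" for i
    proof (cases "i \<in> {1..n}")
      case True
      then show ?thesis using \<open>m \<in> short_weights n k 0\<close> that by (simp add: short_weights_def)
    qed (use \<open>m \<in> short_weights n k 0\<close> in \<open>simp add: short_weights_def level_weights_def\<close>)
    have "(\<Sum>j=1..n. m j) = (\<Sum>j=1..n. if j = n then m n else 0)"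
      by (rule sum.cong) (use z in auto)
    then have "m n = k" using that 0 by (simp add: short_weights_def level_weights_def)
    then show ?thesis using z by (auto simp: vacuum_def fun_eq_iff)
  qed
  moreover have "vacuum n k \<in> short_weights n k 0"
    using 0 vacuum_in[of n k] by (simp add: short_weights_def) (simp add: vacuum_def)
  ultimately have "short_weights n k 0 = {vacuum n k}" by blast
  moreover have "psize n (partition_of_weight n (vacuum n k)) = 0"
    using 0 by (auto simp: psize_def partition_of_weight_def vacuum_def)
  ultimately show ?case by (simp add: paths_0 hop_count_def gl_dim_def)
next
  case (Suc R)
  let ?ps = "\<lambda>m. psize n (partition_of_weight n m)"
  have R: "Suc R < n" by fact
  define B where "B m' = PiE {..<R} (\<lambda>j. {..m' (Suc j)})" for m' :: "nat \<Rightarrow> nat"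
  have ps: "?ps m + (\<Sum>j=1..n. a j) = ?ps (hop n m a)"
    if "m \<in> short_weights n k R" "a \<in> hops_from n m" for m a
    using psize_hop[OF _ that(2)] hop_short(2)[OF R that] R by simp
  have "(\<Sum>c\<in>paths n (Suc R) (vacuum n k). F (fst c (Suc R)) (hop_count n (Suc R) c))
    = (\<Sum>c\<in>paths n R (vacuum n k). \<Sum>b\<in>hops_from n (fst c R). F (hop n (fst c R) b) (hop_count n R c + (\<Sum>j=1..n. b j)))"
    by (rule sum_paths_Suc)
  also have "\<dots> = (\<Sum>m\<in>short_weights n k R. gl_dim n R m * (\<Sum>b\<in>hops_from n m. F (hop n m b) (?ps m + (\<Sum>j=1..n. b j))))"
    using Suc.prems by (intro Suc.IH) auto
  also have "\<dots> = (\<Sum>m\<in>short_weights n k R. \<Sum>b\<in>hops_from n m. gl_dim n R m * F (hop n m b) (?ps (hop n m b)))"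
    by (intro sum.cong refl) (simp add: sum_distrib_left ps[simplified])
  also have "\<dots> = (\<Sum>(m,b)\<in>(SIGMA m:short_weights n k R. hops_from n m). gl_dim n R m * F (hop n m b) (?ps (hop n m b)))"
    by (rule sum.Sigma) (auto simp: finite_short_weights finite_hops_from)
  also have "\<dots> = (\<Sum>(m',g)\<in>(SIGMA m':short_weights n k (Suc R). B m').
      gl_dim n R (unhop n R m' g) * F m' (?ps m'))"
    by (rule sum.reindex_bij_witness[of _ "\<lambda>(m',g). (unhop n R m' g, unhop_hops n R m' g)" "\<lambda>(m,a). (hop n m a, stayers R m a)"])
      (use hop_short(1)[OF R] unhop_hop[OF R, folded B_def] hop_unhop[OF R, folded B_def] in \<open>auto\<close>)
  also have "\<dots> = (\<Sum>m'\<in>short_weights n k (Suc R). (\<Sum>g\<in>B m'. gl_dim n R (unhop n R m' g)) * F m' (?ps m'))"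
    by (subst sum.Sigma[symmetric]) (auto simp: finite_short_weights sum_distrib_right B_def intro!: finite_PiE)
  also have "\<dots> = (\<Sum>m'\<in>short_weights n k (Suc R). gl_dim n (Suc R) m' * F m' (?ps m'))"
    by (rule sum.cong[OF refl]) (simp only: gl_dim_branching[OF R] B_def)
  finally show ?case .
qed

lemma gl_dim_eq_hook_content:
  assumes n: "n \<ge> 2" and m: "m \<in> level_weights n k"
  shows "gl_dim n (n - 1) m = (\<Prod>s \<in> young_diagram n (partition_of_weight n m).
          of_int (int n - 1 + content s) / of_int (hook n (partition_of_weight n m) s))"
proof -
  have "partition_of_weight n m \<in> box_partitions n k" by (rule partition_of_weight_in[OF n m])
  then have dec: "partition_of_weight n m j \<le> partition_of_weight n m i" if "1 \<le> i" "i \<le> j" "j \<le> n - 1" for i j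
    using that by (simp add: box_partitions_def)
  have "(\<Prod>s \<in> young_diagram n (partition_of_weight n m).
      of_int (int n - 1 + content s) / of_int (hook n (partition_of_weight n m) s) :: complex)
    = det (mat (n-1) (n-1) (\<lambda>(i,j). of_nat (partition_of_weight n m (Suc j) + (n - 1 - 1 - j) choose (n - 1 - 1 - i))))"
    by (rule hook_content_formula[OF dec]) (use n in auto)
  then show ?thesis by (simp only: gl_dim_def partition_of_weight_eq_tail_sum)
qed

lemma short_weights_all: "n \<ge> 1 \<Longrightarrow> short_weights n k (n - 1) = level_weights n k"
  by (auto simp: short_weights_def)

section \<open>Orthogonality of the S-matrix\<close>

lemma alternant_leibniz:
  "alternant n y L = (\<Sum>p | p permutes {0..<n}. of_int (sign p) * (\<Prod>i=0..<n. y i ^ L (p i)))"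
  unfolding alternant_def by (subst det_def'[of _ n]) (auto intro!: sum.cong prod.cong)

lemma alternant_cong:
  assumes "\<And>i. i < n \<Longrightarrow> y i = y' i" "\<And>i. i < n \<Longrightarrow> L i = L' i"
  shows "alternant n y L = alternant n y' L'"
  unfolding alternant_def by (intro arg_cong[where f = det] eq_matI) (simp_all add: assms)

lemma alternant_permute:
  assumes p: "p permutes {0..<n}"
  shows "alternant n (\<lambda>i. y (p i)) L = of_int (sign p) * alternant n y L"
proof -
  have "p i < n" if "i < n" for i using permutes_in_image[OF p, of i] that by simp
  then have "mat n n (\<lambda>(i,j). y (p i) ^ L j) = mat n n (\<lambda>(i,j). mat n n (\<lambda>(i,j). y i ^ L j) $$ (p i, j))"
    by (intro eq_matI) auto
  then show ?thesis
    using det_permute_rows[OF _ p, of "mat n n (\<lambda>(i,j). y i ^ L j)"] by (simp add: alternant_def)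
qed

lemma alternant_eq_0:
  assumes "i < n" "j < n" "i \<noteq> j" "y i = y j"
  shows "alternant n y L = 0"
  unfolding alternant_def
  by (rule det_identical_rows[of _ n i j]) (use assms in \<open>auto intro!: eq_vecI\<close>)

lemma decreasing_gap:
  fixes u :: "nat \<Rightarrow> nat"
  assumes dec: "\<And>i j. i < j \<Longrightarrow> j < n \<Longrightarrow> u j < u i" and ij: "i \<le> j" "j < n"
  shows "u j + (j - i) \<le> u i"
  using ij
proof (induction j rule: dec_induct)
  case (step j)
  then show ?case using dec[of j "Suc j"] by (simp add: Suc_diff_le)
qed simp

text \<open>Read backwards, each sequence is the sorted list of its set of values.\<close>

lemma decreasing_unique:
  fixes u v :: "nat \<Rightarrow> nat"
  assumes u: "\<And>i j. i < j \<Longrightarrow> j < n \<Longrightarrow> u j < u i" and v: "\<And>i j. i < j \<Longrightarrow> j < n \<Longrightarrow> v j < v i"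
    and im: "u ` {0..<n} = v ` {0..<n}" and i: "i < n"
  shows "u i = v i"
proof -
  have srt: "sorted_wrt (<) (map f (rev [0..<n]))" if "\<And>i j. i < j \<Longrightarrow> j < n \<Longrightarrow> f j < f i" for f :: "nat \<Rightarrow> nat"
    unfolding sorted_wrt_iff_nth_less using that by (auto simp: rev_nth)
  have "map u (rev [0..<n]) = map v (rev [0..<n])"
    using im by (intro strict_sorted_equal srt u v) auto
  then show ?thesis using i by auto
qed

text \<open>A point of the open fundamental alcove has a trivial stabiliser in the affine Weyl group,
  and no two of them are conjugate.\<close>

lemma alcove_points_conjugate:
  fixes L L' :: "nat \<Rightarrow> nat" and b :: int
  assumes n: "n \<ge> 1"
    and L: "\<And>i j. i < j \<Longrightarrow> j < n \<Longrightarrow> L j < L i" "\<And>i. i < n \<Longrightarrow> L i < N" "L (n - 1) = 0"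
    and L': "\<And>i j. i < j \<Longrightarrow> j < n \<Longrightarrow> L' j < L' i" "\<And>i. i < n \<Longrightarrow> L' i < N" "L' (n - 1) = 0"
    and w: "w permutes {0..<n}" and w': "w' permutes {0..<n}"
    and dvd: "\<And>i. i < n \<Longrightarrow> int N dvd int (L (w i)) - int (L' (w' i)) - b"
    and sum0: "(\<Sum>i=0..<n. int (L (w i)) - int (L' (w' i)) - b) = 0"
  shows "w = w'" "\<And>i. i < n \<Longrightarrow> L i = L' i"
proof -
  define d where "d i = int (L (w i)) - int (L' (w' i)) - b" for i
  have wn: "w i < n" "w' i < n" if "i < n" for i
    using permutes_in_image[OF w, of i] permutes_in_image[OF w', of i] that by auto
  have diff: "d i - d j < 2 * int N" if "i < n" "j < n" for i j
    using L(2)[OF wn(1)[OF that(1)]] L'(2)[OF wn(2)[OF that(2)]] by (simp add: d_def)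
  \<comment> \<open>The \<open>d i\<close> are multiples of \<open>N\<close> with sum 0. If one were
    nonzero, some \<open>d p \<ge> N\<close> and some \<open>d q \<le> - N\<close> would differ by
    at least \<open>2 * N\<close>, against \<open>diff\<close>.\<close>
  have d0: "d i = 0" if i: "i < n" for i
  proof (rule ccontr)
    assume ne: "d i \<noteq> 0"
    have sumd: "(\<Sum>q=0..<n. d q) = 0" unfolding d_def by (rule sum0)
    have pos: "\<exists>q<n. d q > 0"
    proof (rule ccontr)
      assume "\<not> ?thesis"
      then have "\<And>q. q \<in> {0..<n} \<Longrightarrow> - d q \<ge> 0" by force
      moreover have "(\<Sum>q=0..<n. - d q) = 0" using sumd by (simp add: sum_negf)
      ultimately show False using sum_nonneg_eq_0_iff[of "{0..<n}" "\<lambda>q. - d q"] i ne by auto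
    qed
    have neg: "\<exists>q<n. d q < 0"
    proof (rule ccontr)
      assume "\<not> ?thesis"
      then have "\<And>q. q \<in> {0..<n} \<Longrightarrow> d q \<ge> 0" by force
      then show False using sumd sum_nonneg_eq_0_iff[of "{0..<n}" d] i ne by auto
    qed
    obtain p q where pq: "p < n" "d p > 0" "q < n" "d q < 0" using pos neg by auto
    have dvd': "int N dvd d i" if "i < n" for i using dvd[OF that] by (simp add: d_def)
    have "int N \<le> d p" using zdvd_imp_le[of "int N" "d p"] dvd'[OF pq(1)] pq by simp
    moreover have "int N \<le> - d q"
      using zdvd_imp_le[of "int N" "- d q"] dvd'[OF pq(3)] pq by simp
    ultimately show False using diff[OF pq(1,3)] by simp
  qed
  have eq: "int (L (w i)) = int (L' (w' i)) + b" if "i < n" for i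
    using d0[OF that] by (simp add: d_def)
  \<comment> \<open>At the position where \<open>L\<close> takes the value 0 the equation gives
    \<open>b \<le> 0\<close>, and where \<open>L'\<close> does it gives
    \<open>b \<ge> 0\<close>.\<close>
  have "b = 0"
  proof -
    have "n - 1 \<in> w ` {0..<n}" "n - 1 \<in> w' ` {0..<n}"
      unfolding permutes_image[OF w] permutes_image[OF w'] using n by simp_all
    then obtain i j where i: "n - 1 = w i" "i \<in> {0..<n}" and j: "n - 1 = w' j" "j \<in> {0..<n}"
      by (elim imageE)
    have "int (L' (w' i)) + b = 0" using eq[of i] i L(3) by simp
    moreover have "int (L (w j)) = b" using eq[of j] j L'(3) by simp
    ultimately show ?thesis by linarith
  qed
  then have eq: "L (w i) = L' (w' i)" if "i < n" for i using eq[OF that] by simp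
  have "L ` {0..<n} = L ` (w ` {0..<n})" using permutes_image[OF w] by simp
  also have "\<dots> = L' ` (w' ` {0..<n})" using eq by (auto simp: image_image)
  also have "\<dots> = L' ` {0..<n}" using permutes_image[OF w'] by simp
  finally show LL': "L i = L' i" if "i < n" for i
    using decreasing_unique[of n L L' i] L(1) L'(1) that by blast
  have "w i = w' i" for i
  proof (cases "i < n")
    case True
    then have "L (w i) = L (w' i)" using eq LL'[of "w' i"] wn by simp
    then show ?thesis using L(1)[of "w i" "w' i"] L(1)[of "w' i" "w i"] wn[OF True]
      by (cases "w i" "w' i" rule: linorder_cases) auto
  next
    case False
    then show ?thesis using permutes_not_in[OF w, of i] permutes_not_in[OF w', of i] by simp
  qed
  then show "w = w'" by auto
qed

section \<open>Roots of unity and torus points\<close>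

lemma cis_sum: "cis (\<Sum>i\<in>A. f i) = (\<Prod>i\<in>A. cis (f i))"
  by (induction A rule: infinite_finite_induct) (auto simp: cis_mult[symmetric])

text \<open>The terms are powers of an \<open>N\<close>-th root of unity \<open>z\<close>, and
  \<open>z = 1\<close> exactly if \<open>N\<close> divides \<open>d\<close>.\<close>

lemma sum_roots_of_unity:
  assumes N: "N > 0"
  shows "(\<Sum>t<N. cis (- (2 * pi / real N) * (real t * real_of_int d)))
    = (if int N dvd d then of_nat N else 0)"
proof -
  define z where "z = cis (- (2 * pi / real N) * real_of_int d)"
  have pw: "cis (- (2 * pi / real N) * (real t * real_of_int d)) = z ^ t" for t
    unfolding z_def by (subst DeMoivre) (simp add: mult_ac)
  have "z ^ N = cis (2 * pi * of_int (- d))"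
    unfolding z_def using N by (subst DeMoivre) (simp add: mult_ac)
  then have zN: "z ^ N = 1" by (simp only: cis_multiple_2pi Ints_of_int)
  have z1: "z = 1 \<longleftrightarrow> int N dvd d"
  proof
    assume "z = 1"
    then have "cos (- (2 * pi / real N) * real_of_int d) = 1"
      unfolding z_def by (metis cis.sel(1) one_complex.sel(1))
    then obtain q :: int where "- (2 * pi / real N) * real_of_int d = of_int q * 2 * pi"
      unfolding cos_one_2pi_int by blast
    then have "pi * (real_of_int d + real_of_int q * real N) = 0" using N by (simp add: field_simps)
    then have "real_of_int d = real_of_int (- q * int N)" by simp
    then have "d = - q * int N" by (simp only: of_int_eq_iff)
    then show "int N dvd d" by simp
  next
    assume "int N dvd d"
    then obtain q where "d = int N * q" by blast
    then have "z = cis (2 * pi * of_int (- q))" using N by (simp add: z_def mult_ac)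
    then show "z = 1" by (simp only: cis_multiple_2pi Ints_of_int)
  qed
  show ?thesis
  proof (cases "z = 1")
    case True
    then show ?thesis using z1 by (simp only: pw) simp
  next
    case False
    then show ?thesis using z1 geometric_sum[OF False, of N] zN by (simp only: pw) simp
  qed
qed

text \<open>The points \<open>exp (-2\<pi>i(\<sigma> + \<rho>, \<epsilon>\<^sub>i) / (k + n))\<close>, in terms of an arbitrary integer vector
  \<open>t\<close> representing \<open>\<sigma> + \<rho>\<close> modulo \<open>(1,\<dots>,1)\<close>.\<close>

definition torus_point :: "nat \<Rightarrow> nat \<Rightarrow> (nat \<Rightarrow> nat) \<Rightarrow> nat \<Rightarrow> complex" where
  "torus_point n k t i = cis (- (2 * pi / real (k + n)) * (real (t i) - (\<Sum>j=0..<n. real (t j)) / real n))"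

definition shifted_partition :: "nat \<Rightarrow> (nat \<Rightarrow> nat) \<Rightarrow> nat \<Rightarrow> nat" where
  "shifted_partition n \<sigma> i = \<sigma> (Suc i) + (n - 1 - i)"

lemma shifted_part_eq: "shifted_part n m = shifted_partition n (partition_of_weight n m)"
  by (rule ext) (simp add: shifted_part_def shifted_partition_def partition_of_weight_eq_tail_sum)

text \<open>These inequalities place \<open>\<sigma> + \<rho>\<close>, normalised to last coordinate
  0, in the open fundamental alcove.\<close>

lemma shifted_partition_props:
  assumes n: "n \<ge> 1" and \<sigma>: "\<sigma> \<in> box_partitions n k"
  shows "\<And>i j. i < j \<Longrightarrow> j < n \<Longrightarrow> shifted_partition n \<sigma> j < shifted_partition n \<sigma> i"
    "\<And>i. i < n \<Longrightarrow> shifted_partition n \<sigma> i < k + n" "shifted_partition n \<sigma> (n - 1) = 0"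
proof -
  have z: "\<sigma> i = 0" if "i \<notin> {1..n-1}" for i using \<sigma> that by (simp add: box_partitions_def)
  have mono: "\<sigma> (Suc j) \<le> \<sigma> (Suc i)" if "i \<le> j" for i j
    using \<sigma> that z[of "Suc j"] by (cases "Suc j \<le> n - 1") (auto simp: box_partitions_def)
  have k: "\<sigma> (Suc 0) \<le> k" using \<sigma> by (simp add: box_partitions_def)
  show "shifted_partition n \<sigma> j < shifted_partition n \<sigma> i" if "i < j" "j < n" for i j
    using mono[of i j] that by (simp add: shifted_partition_def)
  show "shifted_partition n \<sigma> i < k + n" if "i < n" for i
    using mono[of 0 i] that k by (simp add: shifted_partition_def)
  show "shifted_partition n \<sigma> (n - 1) = 0" using z[of n] n by (simp add: shifted_partition_def)
qed

lemma torus_point_cong: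
  assumes "\<And>i. i < n \<Longrightarrow> t i = t' i" "i < n"
  shows "torus_point n k t i = torus_point n k t' i"
proof -
  have "(\<Sum>j=0..<n. real (t j)) = (\<Sum>j=0..<n. real (t' j))" by (rule sum.cong) (simp_all add: assms)
  then show ?thesis by (simp add: torus_point_def assms)
qed

text \<open>The \<open>(n - 1)!\<close> counts the orderings of the nonzero entries of the shifted partition.\<close>

lemma sum_vectors_eq_sum_box_partitions:
  fixes f :: "(nat \<Rightarrow> nat) \<Rightarrow> complex"
  assumes n: "n \<ge> 1"
    and cong: "\<And>t t'. (\<And>i. i < n \<Longrightarrow> t i = t' i) \<Longrightarrow> f t = f t'"
    and sym: "\<And>t p. p permutes {0..<n} \<Longrightarrow> f (\<lambda>i. t (p i)) = f t"
    and zero: "\<And>t i j. i < n \<Longrightarrow> j < n \<Longrightarrow> i \<noteq> j \<Longrightarrow> t i = t j \<Longrightarrow> f t = 0"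
  shows "(\<Sum>t\<in>PiE {0..<n} (\<lambda>i. if i = n - 1 then {0} else {..<k + n}). f t)
    = fact (n - 1) * (\<Sum>\<sigma>\<in>box_partitions n k. f (shifted_partition n \<sigma>))"
proof -
  define P where "P = PiE {0..<n} (\<lambda>i. if i = n - 1 then {0::nat} else {..<k + n})"
  define P' where "P' = {t \<in> P. inj_on t {0..<n}}"
  define S where "S = box_partitions n k \<times> {p. p permutes {0..<n-1}}"
  \<comment> \<open>Only the first \<open>n - 1\<close> indices are permuted, since the entry 0 is
    pinned to the last one.\<close>
  define \<Phi> where "\<Phi> = (\<lambda>(\<sigma>, p). \<lambda>i\<in>{0..<n}. shifted_partition n \<sigma> (p i))"
  have finP: "finite P" unfolding P_def by (intro finite_PiE) auto
  note sp = shifted_partition_props[OF n]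
  have perm: "p permutes {0..<n}" if "p permutes {0..<n-1}" for p
    using that by (rule permutes_subset) auto
  have \<Phi>i: "\<Phi> (\<sigma>, p) i = shifted_partition n \<sigma> (p i)" if "i < n" for \<sigma> p i
    using that by (simp add: \<Phi>_def)
  have inj_sp: "i = j" if "\<sigma> \<in> box_partitions n k" "i < n" "j < n" "shifted_partition n \<sigma> i = shifted_partition n \<sigma> j" for \<sigma> i j
    using sp(1)[OF that(1), of i j] sp(1)[OF that(1), of j i] that by (cases i j rule: linorder_cases) auto
  have pin: "p i < n" if "p permutes {0..<n}" "i < n" for p i
    using permutes_in_image[OF that(1), of i] that by simp
  have inj: "inj_on \<Phi> S"
  proof (rule inj_onI, clarify)
    fix \<sigma> p \<sigma>' p' assume mem: "(\<sigma>, p) \<in> S" "(\<sigma>', p') \<in> S" and eq: "\<Phi> (\<sigma>, p) = \<Phi> (\<sigma>', p')"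
    have \<sigma>: "\<sigma> \<in> box_partitions n k" "\<sigma>' \<in> box_partitions n k" using mem by (auto simp: S_def)
    have p: "p permutes {0..<n}" "p' permutes {0..<n}" using mem perm by (auto simp: S_def)
    have e: "shifted_partition n \<sigma> (p i) = shifted_partition n \<sigma>' (p' i)" if "i < n" for i
      using fun_cong[OF eq, of i] that by (simp add: \<Phi>i)
    have "shifted_partition n \<sigma> ` {0..<n} = shifted_partition n \<sigma> ` (p ` {0..<n})"
      using permutes_image[OF p(1)] by simp
    also have "\<dots> = shifted_partition n \<sigma>' ` (p' ` {0..<n})" using e by (auto simp: image_image)
    also have "\<dots> = shifted_partition n \<sigma>' ` {0..<n}" using permutes_image[OF p(2)] by simp
    finally have s: "shifted_partition n \<sigma> i = shifted_partition n \<sigma>' i" if "i < n" for i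
      using decreasing_unique[of n "shifted_partition n \<sigma>" "shifted_partition n \<sigma>'" i] sp(1)[OF \<sigma>(1)] sp(1)[OF \<sigma>(2)] that
      by blast
    have "\<sigma> i = \<sigma>' i" for i
    proof (cases "i \<in> {1..n-1}")
      case True
      then have "i - 1 < n" "Suc (i - 1) = i" by auto
      then show ?thesis using s[of "i - 1"] by (simp add: shifted_partition_def)
    qed (use \<sigma> in \<open>simp add: box_partitions_def\<close>)
    moreover have "p i = p' i" for i
    proof (cases "i < n")
      case True
      then show ?thesis using e[OF True] s[OF pin[OF p(2) True]] inj_sp[OF \<sigma>(1)] pin[OF p(1) True] pin[OF p(2) True] by simp
    next
      case False
      then show ?thesis using permutes_not_in[OF p(1), of i] permutes_not_in[OF p(2), of i] by simp
    qed
    ultimately show "\<sigma> = \<sigma>' \<and> p = p'" by auto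
  qed
  have img: "\<Phi> ` S = P'"
  proof (intro equalityI subsetI)
    fix t assume "t \<in> \<Phi> ` S"
    then obtain \<sigma> p where t: "t = \<Phi> (\<sigma>, p)" and \<sigma>: "\<sigma> \<in> box_partitions n k" and p: "p permutes {0..<n-1}"
      by (auto simp: S_def)
    have pn: "p (n - 1) = n - 1" using permutes_not_in[OF p, of "n - 1"] by simp
    have "inj_on t {0..<n}"
    proof (rule inj_onI)
      fix i j assume ij: "i \<in> {0..<n}" "j \<in> {0..<n}" "t i = t j"
      then have "p i = p j" using inj_sp[OF \<sigma>] pin[OF perm[OF p]] by (simp add: t \<Phi>i)
      then show "i = j" using permutes_inj[OF p] by (simp add: inj_eq)
    qed
    moreover have "t \<in> P"
      unfolding P_def t \<Phi>_def
      using sp(2)[OF \<sigma>] sp(3)[OF \<sigma>] pin[OF perm[OF p]] pn by (simp add: restrict_PiE_iff)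
    ultimately show "t \<in> P'" by (simp add: P'_def)
  next
    fix t assume t: "t \<in> P'"
    define M where "M = t ` {0..<n}"
    have inj_t: "inj_on t {0..<n}" using t by (simp add: P'_def)
    have cM: "finite M" "card M = n" using card_image[OF inj_t] by (simp_all add: M_def)
    obtain h where h: "bij_betw h {..<n} M" "strict_mono_on {..<n} h"
      using ex_bij_betw_strict_mono_card[OF cM(1)] unfolding cM(2) by blast
    have tin: "t i \<in> (if i = n - 1 then {0} else {..<k + n})" if "i < n" for i
    proof -
      have "t \<in> PiE {0..<n} (\<lambda>i. if i = n - 1 then {0} else {..<k + n})" using t by (simp add: P'_def P_def)
      from PiE_mem[OF this, of i] that show ?thesis by simp
    qed
    have tn: "t (n - 1) = 0" using tin[of "n - 1"] n by simp
    have tk: "t i < k + n" if "i < n" for i using tin[OF that] n by (auto split: if_splits)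
    \<comment> \<open>The decreasing enumeration of the values of \<open>t\<close>, obtained by
      reversing \<open>h\<close>.\<close>
    define u where "u i = h (n - 1 - i)" for i
    have u_dec: "u j < u i" if "i < j" "j < n" for i j
      using that strict_mono_onD[OF h(2), of "n - 1 - j" "n - 1 - i"] by (auto simp: u_def)
    have bu: "bij_betw u {0..<n} M"
    proof -
      have "bij_betw (\<lambda>i. n - 1 - i) {0..<n} {..<n}"
        by (rule bij_betw_byWitness[where f' = "\<lambda>i. n - 1 - i"]) auto
      then show ?thesis using bij_betw_trans[OF _ h(1)] unfolding u_def o_def by blast
    qed
    have uM: "u ` {0..<n} = M" using bu by (rule bij_betw_imp_surj_on)
    have u0: "u (n - 1) = 0"
    proof -
      have "0 \<in> u ` {0..<n}" unfolding uM M_def using tn n by (intro image_eqI[of _ _ "n - 1"]) auto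
      then obtain j where j: "j < n" "u j = 0" by auto
      then have "j < n - 1 \<or> j = n - 1" by linarith
      then show ?thesis using u_dec[of j "n - 1"] j by auto
    qed
    have uk: "u i < k + n" if "i < n" for i
    proof -
      have "u i \<in> M" using that unfolding uM[symmetric] by simp
      then show ?thesis using tk by (auto simp: M_def)
    qed
    \<comment> \<open>Removes the staircase: at index \<open>s - 1\<close> its height is
      \<open>n - 1 - (s - 1) = n - s\<close>.\<close>
    define \<sigma> where "\<sigma> s = (if s \<in> {1..n-1} then u (s - 1) - (n - s) else 0)" for s
    have gap: "u j + (j - i) \<le> u i" if "i \<le> j" "j < n" for i j
      by (rule decreasing_gap[OF u_dec that])
    have su: "shifted_partition n \<sigma> i = u i" if "i < n" for i
      using that gap[of i "n - 1"] u0 by (cases "i = n - 1") (auto simp: shifted_partition_def \<sigma>_def)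
    have \<sigma>: "\<sigma> \<in> box_partitions n k"
    proof -
      have "\<sigma> j \<le> \<sigma> i" if "1 \<le> i" "i \<le> j" "j \<le> n - 1" for i j
      proof -
        have "j - 1 < n" "(j - 1) - (i - 1) = j - i" using that by auto
        then have "u (j - 1) + (j - i) \<le> u (i - 1)" using gap[of "i - 1" "j - 1"] that by simp
        then have "u (j - 1) - (n - j) \<le> u (i - 1) - (n - i)" using that by linarith
        then show ?thesis using that by (simp add: \<sigma>_def)
      qed
      moreover have "\<sigma> 1 \<le> k" using uk[of 0] n by (auto simp: \<sigma>_def)
      ultimately show ?thesis by (auto simp: box_partitions_def \<sigma>_def)
    qed
    define p where "p i = (if i < n then inv_into {0..<n} u (t i) else i)" for i
    have up: "u (p i) = t i" if "i < n" for i
      using that f_inv_into_f[of "t i" u "{0..<n}"] by (simp add: p_def uM M_def)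
    have bp: "bij_betw p {0..<n} {0..<n}"
    proof -
      have "bij_betw (inv_into {0..<n} u \<circ> t) {0..<n} {0..<n}"
        using inj_t by (intro bij_betw_trans[OF _ bij_betw_inv_into[OF bu]]) (simp add: bij_betw_def M_def)
      then show ?thesis by (rule bij_betw_cong[THEN iffD1, rotated]) (simp add: p_def)
    qed
    then have pp: "p permutes {0..<n}" by (rule bij_imp_permutes) (simp add: p_def)
    \<comment> \<open>The pinned entry 0 is the least value of \<open>t\<close>, which
      \<open>u\<close> takes at index \<open>n - 1\<close>.\<close>
    have "p (n - 1) = n - 1"
    proof -
      have "p (n - 1) < n" using pin[OF pp, of "n - 1"] n by simp
      then have "p (n - 1) < n - 1 \<or> p (n - 1) = n - 1" by linarith
      moreover have "u (p (n - 1)) = 0" using up[of "n - 1"] tn n by simp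
      ultimately show ?thesis using u_dec[of "p (n - 1)" "n - 1"] n by auto
    qed
    moreover have "x = n - 1" if "x \<in> {0..<n} - {0..<n-1}" for x using that by auto
    ultimately have "p permutes {0..<n-1}"
      by (intro permutes_superset[OF pp]) metis
    moreover have "t = \<Phi> (\<sigma>, p)"
    proof (rule extensionalityI[of _ "{0..<n}"])
      show "t \<in> extensional {0..<n}" using t by (simp add: P'_def P_def PiE_def)
      fix i assume "i \<in> {0..<n}"
      then show "t i = \<Phi> (\<sigma>, p) i" using su[OF pin[OF pp]] up by (simp add: \<Phi>i)
    qed (simp add: \<Phi>_def)
    ultimately show "t \<in> \<Phi> ` S" using \<sigma> by (auto simp: S_def)
  qed
  \<comment> \<open>Vectors with a repeated entry contribute 0.\<close>
  have "(\<Sum>t\<in>P. f t) = (\<Sum>t\<in>P'. f t)"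
    by (rule sum.mono_neutral_right[OF finP]) (auto simp: P'_def inj_on_def intro: zero)
  also have "\<dots> = (\<Sum>s\<in>S. f (\<Phi> s))"
    unfolding img[symmetric] by (subst sum.reindex[OF inj]) simp
  also have "\<dots> = (\<Sum>(\<sigma>, p)\<in>S. f (shifted_partition n \<sigma>))"
  proof (rule sum.cong[OF refl], clarify)
    fix \<sigma> p assume "(\<sigma>, p) \<in> S"
    then have p: "p permutes {0..<n}" using perm by (simp add: S_def)
    have "f (\<Phi> (\<sigma>, p)) = f (\<lambda>i. shifted_partition n \<sigma> (p i))" by (rule cong) (simp add: \<Phi>i)
    then show "f (\<Phi> (\<sigma>, p)) = f (shifted_partition n \<sigma>)" by (simp add: sym[OF p])
  qed
  also have "\<dots> = (\<Sum>\<sigma>\<in>box_partitions n k. \<Sum>p | p permutes {0..<n-1}. f (shifted_partition n \<sigma>))"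
    unfolding S_def by (rule sum.Sigma[symmetric]) (simp_all add: finite_box_partitions finite_permutations)
  also have "\<dots> = fact (n - 1) * (\<Sum>\<sigma>\<in>box_partitions n k. f (shifted_partition n \<sigma>))"
    by (simp add: card_permutations[of _ "n - 1"] sum_distrib_left)
  finally show ?thesis by (simp only: P_def)
qed

lemma sum_shifted_partition:
  assumes n: "n \<ge> 1" and \<sigma>: "\<sigma> \<in> box_partitions n k"
  shows "(\<Sum>j=0..<n. shifted_partition n \<sigma> j) = psize n \<sigma> + n * (n - 1) div 2"
proof -
  obtain r where r: "n = Suc r" using n by (cases n) auto
  have "\<sigma> (Suc r) = 0" using \<sigma> by (simp add: box_partitions_def r)
  moreover have "(\<Sum>j<r. \<sigma> (Suc j)) = (\<Sum>i=1..r. \<sigma> i)"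
    by (rule sum.reindex_bij_witness[of _ "\<lambda>i. i - 1" Suc]) auto
  ultimately have "(\<Sum>j<n. \<sigma> (Suc j)) = psize n \<sigma>" by (simp add: r psize_def)
  moreover have "(\<Sum>j<n. n - 1 - j) = n * (n - 1) div 2"
  proof -
    have "(\<Sum>j<n. n - 1 - j) = (\<Sum>j<n. j)" using sum.nat_diff_reindex[of "\<lambda>j. j" n] by simp
    then show ?thesis using Sum_Ico_nat[of 0 n] by (simp add: lessThan_atLeast0)
  qed
  ultimately show ?thesis
    unfolding shifted_partition_def sum.distrib lessThan_atLeast0 by simp
qed

text \<open>The angles have their mean subtracted, so they sum to 0.\<close>

lemma torus_point_prod:
  assumes "n \<ge> 1"
  shows "(\<Prod>i<n. torus_point n k t i) = 1"
proof -
  let ?T = "\<Sum>j=0..<n. real (t j)"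
  have "(\<Sum>i<n. - (2 * pi / real (k + n)) * (real (t i) - ?T / real n)) = 0"
    unfolding sum_distrib_left[symmetric] sum_subtractf using assms by (simp add: atLeast0LessThan)
  then show ?thesis unfolding torus_point_def cis_sum[symmetric] by simp
qed

text \<open>The integer \<open>t i\<close> contributes full turns, and only the mean survives, which
  does not depend on \<open>i\<close>. With the preceding lemma this supplies the assumptions on
  \<open>y\<close> in \<open>transfer_alternant\<close>.\<close>

lemma torus_point_power:
  assumes "n \<ge> 1"
  shows "torus_point n k t i ^ (k + n) = cis (2 * pi * (\<Sum>j=0..<n. real (t j)) / real n)"
proof -
  have N: "real (k + n) \<noteq> 0" using assms by simp
  have "torus_point n k t i ^ (k + n)
      = cis (2 * pi * (\<Sum>j=0..<n. real (t j)) / real n + 2 * pi * of_int (- int (t i)))"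
    unfolding torus_point_def DeMoivre
  proof (rule arg_cong[where f = cis])
    have "real (k + n) * (- (2 * pi / real (k + n)) * z) = - (2 * pi * z)" for z
      using N by (simp del: of_nat_add)
    then show "real (k + n) * (- (2 * pi / real (k + n)) * (real (t i) - (\<Sum>j=0..<n. real (t j)) / real n))
        = 2 * pi * (\<Sum>j=0..<n. real (t j)) / real n + 2 * pi * of_int (- int (t i))"
      by (simp only:) (simp add: algebra_simps)
  qed
  then show ?thesis
    unfolding cis_mult[symmetric] by (simp only: cis_multiple_2pi Ints_of_int mult_1_right)
qed

text \<open>The mean \<open>T / n\<close> is multiplied by the degree difference
  \<open>n * b\<close>. The result \<open>b * T\<close> is again a sum over the \<open>t i\<close>
  with integer coefficients, so it is absorbed into the exponents.\<close>

lemma torus_point_monomial: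
  fixes a a' :: "nat \<Rightarrow> nat"
  assumes n: "n \<ge> 1" and b: "(\<Sum>i=0..<n. int (a i) - int (a' i)) = int n * b"
  shows "(\<Prod>i=0..<n. torus_point n k t i ^ a i) * cnj (\<Prod>i=0..<n. torus_point n k t i ^ a' i)
    = (\<Prod>i=0..<n. cis (- (2 * pi / real (k + n)) * (real (t i) * real_of_int (int (a i) - int (a' i) - b))))"
proof -
  define c where "c = - (2 * pi / real (k + n))"
  define T where "T = (\<Sum>j=0..<n. real (t j))"
  have b': "(\<Sum>i=0..<n. real (a i) - real (a' i)) = real n * of_int b"
    using arg_cong[OF b, of real_of_int] by simp
  have "(\<Sum>i=0..<n. c * (real (t i) - T / real n) * (real (a i) - real (a' i)))
      = (\<Sum>i=0..<n. c * (real (t i) * (real (a i) - real (a' i))))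
        - c * T / real n * (\<Sum>i=0..<n. real (a i) - real (a' i))"
    unfolding sum_distrib_left sum_subtractf[symmetric] by (rule sum.cong) (simp_all add: algebra_simps)
  also have "c * T / real n * (\<Sum>i=0..<n. real (a i) - real (a' i)) = (\<Sum>i=0..<n. c * (real (t i) * of_int b))"
  proof -
    have "c * T / real n * (real n * of_int b) = c * of_int b * T" using n by simp
    then show ?thesis unfolding b' by (simp add: T_def sum_distrib_left mult_ac)
  qed
  also have "(\<Sum>i=0..<n. c * (real (t i) * (real (a i) - real (a' i)))) - (\<Sum>i=0..<n. c * (real (t i) * of_int b))
      = (\<Sum>i=0..<n. c * (real (t i) * real_of_int (int (a i) - int (a' i) - b)))"
    unfolding sum_subtractf[symmetric] by (rule sum.cong) (simp_all add: algebra_simps)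
  finally have S: "(\<Sum>i=0..<n. c * (real (t i) - T / real n) * (real (a i) - real (a' i)))
      = (\<Sum>i=0..<n. c * (real (t i) * real_of_int (int (a i) - int (a' i) - b)))" .
  have gen: "cis z ^ p * cnj (cis z ^ q) = cis (z * (real p - real q))" for z p q
    by (simp add: DeMoivre cis_cnj cis_mult algebra_simps)
  have tp: "torus_point n k t i = cis (c * (real (t i) - T / real n))" for i
    by (simp only: torus_point_def c_def T_def)
  have "(\<Prod>i=0..<n. torus_point n k t i ^ a i) * cnj (\<Prod>i=0..<n. torus_point n k t i ^ a' i)
      = (\<Prod>i=0..<n. cis (c * (real (t i) - T / real n) * (real (a i) - real (a' i))))"
    unfolding cnj_prod prod.distrib[symmetric]
    by (rule prod.cong) (simp_all only: gen tp)
  then show ?thesis unfolding cis_sum[symmetric] S by (simp only: c_def)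
qed

lemma shifted_part_props:
  assumes n: "n \<ge> 2" and m: "m \<in> level_weights n k"
  shows "\<And>i j. i < j \<Longrightarrow> j < n \<Longrightarrow> shifted_part n m j < shifted_part n m i"
    "\<And>i. i < n \<Longrightarrow> shifted_part n m i < k + n" "shifted_part n m (n - 1) = 0"
    "(\<Sum>j=0..<n. shifted_part n m j) = psize n (partition_of_weight n m) + n * (n - 1) div 2"
  using shifted_partition_props[OF _ partition_of_weight_in[OF n m]]
    sum_shifted_partition[OF _ partition_of_weight_in[OF n m]] n
  unfolding shifted_part_eq by simp_all

lemma weight_eqI:
  assumes n: "n \<ge> 2" and m: "m \<in> level_weights n k" "m' \<in> level_weights n k"
    and eq: "\<And>i. i < n \<Longrightarrow> shifted_part n m i = shifted_part n m' i"
  shows "m = m'"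
proof -
  have z: "partition_of_weight n m i = 0" if "i \<notin> {1..n-1}" for m i
    using that by (auto simp: partition_of_weight_def)
  have "partition_of_weight n m i = partition_of_weight n m' i" for i
  proof (cases "i \<in> {1..n-1}")
    case True
    then have "i - 1 < n" "Suc (i - 1) = i" by auto
    then show ?thesis using eq[of "i - 1"] by (simp add: shifted_part_eq shifted_partition_def)
  next
    case False
    then show ?thesis by (simp only: z[OF False])
  qed
  then have "partition_of_weight n m = partition_of_weight n m'" by auto
  then show ?thesis
    using partition_of_weight_inverse[OF n m(1)] partition_of_weight_inverse[OF n m(2)] by metis
qed

section \<open>Orthogonality of alternants\<close>

text \<open>After Leibniz expansion the sum over \<open>t\<close> factors, for each pair of
  permutations, into sums over roots of unity. It survives only if all exponents are divisible by
  \<open>k + n\<close>, and the alcove lemma then forces \<open>p = q\<close> and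
  \<open>\<mu> = \<nu>\<close>. The \<open>fact n\<close> diagonal pairs contribute
  \<open>(k + n) ^ (n - 1)\<close> each.\<close>

lemma alternant_gram_vectors:
  assumes n: "n \<ge> 2" and \<mu>: "\<mu> \<in> level_weights n k" and \<nu>: "\<nu> \<in> level_weights n k"
    and b: "int (psize n (partition_of_weight n \<mu>)) - int (psize n (partition_of_weight n \<nu>)) = int n * b"
  shows "(\<Sum>t\<in>PiE {0..<n} (\<lambda>i. if i = n - 1 then {0} else {..<k + n}).
      alternant n (torus_point n k t) (shifted_part n \<mu>) * cnj (alternant n (torus_point n k t) (shifted_part n \<nu>)))
    = (if \<mu> = \<nu> then fact n * of_nat (k + n) ^ (n - 1) else 0)"
proof -
  define N where "N = k + n"
  define L where "L = shifted_part n \<mu>"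
  define L' where "L' = shifted_part n \<nu>"
  define P where "P = {p. p permutes {0..<n}}"
  define B where "B i = (if i = n - 1 then {0} else {..<N})" for i
  define d where "d p q i = int (L (p i)) - int (L' (q i)) - b" for p q :: "nat \<Rightarrow> nat" and i
  have N: "N > 0" using n by (simp add: N_def)
  have n1: "n \<ge> 1" using n by simp
  have sumL: "(\<Sum>i=0..<n. int (L i)) - (\<Sum>i=0..<n. int (L' i)) = int n * b"
    using b shifted_part_props(4)[OF n \<mu>] shifted_part_props(4)[OF n \<nu>] n
    by (simp add: L_def L'_def flip: of_nat_sum)
  have perm_sum: "(\<Sum>i=0..<n. int (L (p i)) - int (L' (q i))) = int n * b" if "p \<in> P" "q \<in> P" for p q
    using sum.permute[of p "{0..<n}" "\<lambda>i. int (L i)"] sum.permute[of q "{0..<n}" "\<lambda>i. int (L' i)"] that sumL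
    by (simp add: P_def sum_subtractf o_def)
  have d0: "(\<Sum>i=0..<n. d p q i) = 0" if "p \<in> P" "q \<in> P" for p q
    using perm_sum[OF that] by (simp add: d_def sum_subtractf)
  have finB: "finite (B i)" for i by (simp add: B_def)
  have inner: "(\<Sum>t\<in>PiE {0..<n} B. (\<Prod>i=0..<n. torus_point n k t i ^ L (p i)) * cnj (\<Prod>i=0..<n. torus_point n k t i ^ L' (q i)))
      = (if \<mu> = \<nu> \<and> p = q then of_nat N ^ (n - 1) else 0)" if pq: "p \<in> P" "q \<in> P" for p q
  proof -
    have "(\<Sum>t\<in>PiE {0..<n} B. (\<Prod>i=0..<n. torus_point n k t i ^ L (p i)) * cnj (\<Prod>i=0..<n. torus_point n k t i ^ L' (q i)))
      = (\<Sum>t\<in>PiE {0..<n} B. \<Prod>i=0..<n. cis (- (2 * pi / real N) * (real (t i) * real_of_int (d p q i))))"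
      unfolding torus_point_monomial[OF n1 perm_sum[OF pq]] d_def N_def ..
    also have "\<dots> = (\<Prod>i=0..<n. \<Sum>t\<in>B i. cis (- (2 * pi / real N) * (real t * real_of_int (d p q i))))"
      by (rule prod_sum_PiE[symmetric]) (simp_all add: finB)
    \<comment> \<open>The coordinate \<open>n - 1\<close> is pinned to 0 and contributes the factor
      1.\<close>
    also have "\<dots> = (\<Prod>i=0..<n-1. \<Sum>t<N. cis (- (2 * pi / real N) * (real t * real_of_int (d p q i))))"
    proof -
      have set: "{0..<n} = insert (n - 1) {0..<n-1}" using n by auto
      show ?thesis unfolding set by (subst prod.insert) (auto simp: B_def intro!: prod.cong)
    qed
    also have "\<dots> = (\<Prod>i=0..<n-1. if int N dvd d p q i then of_nat N else 0)"
      by (simp only: sum_roots_of_unity[OF N])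
    also have "\<dots> = (if \<mu> = \<nu> \<and> p = q then of_nat N ^ (n - 1) else 0)"
    proof (cases "\<forall>i<n-1. int N dvd d p q i")
      case True
      have split: "(\<Sum>i=0..<n. d p q i) = d p q (n - 1) + (\<Sum>i=0..<n-1. d p q i)"
      proof -
        have "{0..<n} = insert (n - 1) {0..<n-1}" using n by auto
        then show ?thesis by simp
      qed
      have "int N dvd (\<Sum>i=0..<n-1. d p q i)" using True by (intro dvd_sum) auto
      \<comment> \<open>Divisibility at the pinned coordinate is recovered from the vanishing
        total.\<close>
      then have "int N dvd d p q (n - 1)" using split d0[OF pq] by (metis add_eq_0_iff dvd_minus_iff)
      moreover have "i < n - 1 \<or> i = n - 1" if "i < n" for i using that by linarith
      ultimately have all: "int N dvd int (L (p i)) - int (L' (q i)) - b" if "i < n" for i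
        using True that unfolding d_def[symmetric] by blast
      have pp: "p permutes {0..<n}" "q permutes {0..<n}" using pq by (auto simp: P_def)
      note Lp = shifted_part_props(1-3)[OF n \<mu>, folded L_def N_def] and Lp' = shifted_part_props(1-3)[OF n \<nu>, folded L'_def N_def]
      have "p = q" by (rule alcove_points_conjugate(1)[OF n1 Lp Lp' pp all d0[OF pq, unfolded d_def]])
      moreover have "\<mu> = \<nu>"
        using alcove_points_conjugate(2)[OF n1 Lp Lp' pp all d0[OF pq, unfolded d_def]]
        by (intro weight_eqI[OF n \<mu> \<nu>]) (simp add: L_def L'_def)
      ultimately show ?thesis using True by simp
    next
      case False
      have ne: "\<not> (\<mu> = \<nu> \<and> p = q)"
      proof
        assume "\<mu> = \<nu> \<and> p = q"
        then have "d p q i = 0" for i using b n by (simp add: d_def L_def L'_def)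
        then show False using False by simp
      qed
      have "(\<Prod>i=0..<n-1. if int N dvd d p q i then of_nat N else 0 :: complex) = 0"
        using False by (intro prod_zero) auto
      then show ?thesis unfolding if_not_P[OF ne] .
    qed
    finally show ?thesis .
  qed
  have "(\<Sum>t\<in>PiE {0..<n} B. alternant n (torus_point n k t) L * cnj (alternant n (torus_point n k t) L'))
    = (\<Sum>t\<in>PiE {0..<n} B. \<Sum>p\<in>P. \<Sum>q\<in>P. of_int (sign p) * of_int (sign q) *
        ((\<Prod>i=0..<n. torus_point n k t i ^ L (p i)) * cnj (\<Prod>i=0..<n. torus_point n k t i ^ L' (q i))))"
    unfolding alternant_leibniz P_def cnj_sum sum_product
    by (intro sum.cong refl) (simp add: mult_ac)
  also have "\<dots> = (\<Sum>p\<in>P. \<Sum>q\<in>P. of_int (sign p) * of_int (sign q) *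
        (\<Sum>t\<in>PiE {0..<n} B. (\<Prod>i=0..<n. torus_point n k t i ^ L (p i)) * cnj (\<Prod>i=0..<n. torus_point n k t i ^ L' (q i))))"
    by (subst sum.swap, rule sum.cong[OF refl], subst sum.swap) (simp only: sum_distrib_left)
  also have "\<dots> = (\<Sum>p\<in>P. \<Sum>q\<in>P. if p = q then (if \<mu> = \<nu> then of_nat N ^ (n - 1) else 0) else 0)"
  proof (intro sum.cong refl)
    fix p q assume pq: "p \<in> P" "q \<in> P"
    show "of_int (sign p) * of_int (sign q) *
        (\<Sum>t\<in>PiE {0..<n} B. (\<Prod>i=0..<n. torus_point n k t i ^ L (p i)) * cnj (\<Prod>i=0..<n. torus_point n k t i ^ L' (q i)))
      = (if p = q then (if \<mu> = \<nu> then of_nat N ^ (n - 1) else 0) else 0)"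
      unfolding inner[OF pq] by (auto simp flip: of_int_mult)
  qed
  also have "\<dots> = (if \<mu> = \<nu> then fact n * of_nat N ^ (n - 1) else 0)"
    by (simp add: P_def finite_permutations card_permutations[of _ n])
  finally show ?thesis by (simp only: B_def[abs_def] L_def L'_def N_def)
qed

text \<open>In the summand the two permutation signs cancel, and it vanishes at vectors with
  repeated entries. The sum over vectors thus counts each partition \<open>fact (n - 1)\<close>
  times, leaving \<open>fact n / fact (n - 1) = n\<close>.\<close>

lemma alternant_gram:
  assumes n: "n \<ge> 2" and \<mu>: "\<mu> \<in> level_weights n k" and \<nu>: "\<nu> \<in> level_weights n k"
    and b: "int (psize n (partition_of_weight n \<mu>)) - int (psize n (partition_of_weight n \<nu>)) = int n * b"
  shows "(\<Sum>\<sigma>\<in>box_partitions n k. alternant n (torus_point n k (shifted_partition n \<sigma>)) (shifted_part n \<mu>)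
      * cnj (alternant n (torus_point n k (shifted_partition n \<sigma>)) (shifted_part n \<nu>)))
    = (if \<mu> = \<nu> then of_nat n * of_nat (k + n) ^ (n - 1) else 0)"
proof -
  define f where "f t = alternant n (torus_point n k t) (shifted_part n \<mu>)
      * cnj (alternant n (torus_point n k t) (shifted_part n \<nu>))" for t
  have tp: "torus_point n k (\<lambda>i. t (p i)) = (\<lambda>i. torus_point n k t (p i))" if "p permutes {0..<n}" for t p
    using sum.permute[OF that, of "\<lambda>i. real (t i)"] by (auto simp: torus_point_def o_def)
  have sgn: "(of_int (sign p) :: complex) * of_int (sign p) = 1" for p :: "nat \<Rightarrow> nat"
    by (simp flip: of_int_mult)
  have "(\<Sum>t\<in>PiE {0..<n} (\<lambda>i. if i = n - 1 then {0} else {..<k + n}). f t)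
      = fact (n - 1) * (\<Sum>\<sigma>\<in>box_partitions n k. f (shifted_partition n \<sigma>))"
  proof (rule sum_vectors_eq_sum_box_partitions)
    show "n \<ge> 1" using n by simp
    show "f t = f t'" if "\<And>i. i < n \<Longrightarrow> t i = t' i" for t t'
    proof -
      have "alternant n (torus_point n k t) L = alternant n (torus_point n k t') L" for L
        by (rule alternant_cong[OF torus_point_cong[OF that]]) simp_all
      then show ?thesis by (simp only: f_def)
    qed
    show "f (\<lambda>i. t (p i)) = f t" if "p permutes {0..<n}" for t p
    proof -
      have "of_int (sign p) * X * cnj (of_int (sign p) * Y) = X * cnj Y" for X Y
        using sgn[of p] by (simp add: mult_ac)
      then show ?thesis by (simp only: f_def tp[OF that] alternant_permute[OF that])
    qed
    show "f t = 0" if "i < n" "j < n" "i \<noteq> j" "t i = t j" for t i j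
    proof -
      have "torus_point n k t i = torus_point n k t j" using that(4) by (simp add: torus_point_def)
      from alternant_eq_0[OF that(1-3) this] show ?thesis by (simp add: f_def)
    qed
  qed
  then have "fact (n - 1) * (\<Sum>\<sigma>\<in>box_partitions n k. f (shifted_partition n \<sigma>))
      = (if \<mu> = \<nu> then fact n * of_nat (k + n) ^ (n - 1) else 0)"
    using alternant_gram_vectors[OF n \<mu> \<nu> b] by (simp only: f_def)
  also have "(fact n :: complex) = fact (n - 1) * of_nat n"
    using n by (simp add: fact_reduce mult.commute)
  also have "(if \<mu> = \<nu> then fact (n - 1) * of_nat n * of_nat (k + n) ^ (n - 1) else 0)
      = fact (n - 1) * (if \<mu> = \<nu> then of_nat n * of_nat (k + n) ^ (n - 1) else 0 :: complex)" by simp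
  finally show ?thesis by (simp only: f_def mult_cancel_left fact_nonzero simp_thms)
qed

section \<open>The S-matrix in terms of alternants\<close>

lemma leibniz_one_based:
  fixes A :: "nat \<Rightarrow> nat \<Rightarrow> 'a::comm_ring_1"
  shows "(\<Sum>w | w permutes {1..n}. of_int (sign w) * (\<Prod>i=1..n. A i (w i)))
    = det (mat n n (\<lambda>(i,j). A (Suc i) (Suc j)))"
proof -
  have bS: "bij_betw Suc {0..<n} {1..n}" by (auto simp: bij_betw_def image_Suc_atLeastLessThan)
  have mp: "(\<lambda>x. if x \<in> {1..n} then Suc (p (inv_into {0..<n} Suc x)) else x) = map_permutation {0..<n} Suc p" for p
    by (auto simp: map_permutation_def restrict_id_def image_Suc_atLeastLessThan fun_eq_iff)
  have bp: "bij_betw (\<lambda>p. map_permutation {0..<n} Suc p) {p. p permutes {0..<n}} {w. w permutes {1..n}}"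
    using bij_betw_permutations[OF bS] unfolding mp .
  have "(\<Sum>w | w permutes {1..n}. of_int (sign w) * (\<Prod>i=1..n. A i (w i)))
    = (\<Sum>p | p permutes {0..<n}. of_int (sign (map_permutation {0..<n} Suc p))
          * (\<Prod>i=1..n. A i (map_permutation {0..<n} Suc p i)))"
    by (rule sum.reindex_bij_betw[OF bp, symmetric])
  also have "\<dots> = (\<Sum>p | p permutes {0..<n}. of_int (sign p) * (\<Prod>i=0..<n. A (Suc i) (Suc (p i))))"
  proof (rule sum.cong[OF refl], clarify)
    fix p assume p: "p permutes {0..<n}"
    have "map_permutation {0..<n} Suc p (Suc i) = Suc (p i)" if "i \<in> {0..<n}" for i
      by (rule map_permutation_apply) (use that in auto)
    then have "(\<Prod>i=1..n. A i (map_permutation {0..<n} Suc p i)) = (\<Prod>i=0..<n. A (Suc i) (Suc (p i)))"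
      unfolding prod.reindex_bij_betw[OF bS, symmetric] by (intro prod.cong refl) simp
    then show "of_int (sign (map_permutation {0..<n} Suc p)) * (\<Prod>i=1..n. A i (map_permutation {0..<n} Suc p i))
      = of_int (sign p) * (\<Prod>i=0..<n. A (Suc i) (Suc (p i)))"
      by (simp add: sign_map_permutation p)
  qed
  also have "\<dots> = det (mat n n (\<lambda>(i,j). A (Suc i) (Suc j)))"
    by (subst det_def'[of _ n]) (auto intro!: sum.cong prod.cong)
  finally show ?thesis .
qed

definition S_prefactor :: "nat \<Rightarrow> nat \<Rightarrow> complex" where
  "S_prefactor n k = exp (\<i> * of_real (pi * real n * (real n - 1) / 4)) / of_real (sqrt (real n * real (k + n) ^ (n - 1)))"

lemma S_prefactor_norm:
  assumes "n \<ge> 1"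
  shows "S_prefactor n k * cnj (S_prefactor n k) = 1 / (of_nat n * of_nat (k + n) ^ (n - 1))" "S_prefactor n k \<noteq> 0"
proof -
  have "norm (S_prefactor n k) = 1 / sqrt (real n * real (k + n) ^ (n - 1))"
    by (simp add: S_prefactor_def norm_divide)
  then have "(norm (S_prefactor n k))\<^sup>2 = 1 / (real n * real (k + n) ^ (n - 1))"
    by (simp add: power_divide)
  then show "S_prefactor n k * cnj (S_prefactor n k) = 1 / (of_nat n * of_nat (k + n) ^ (n - 1))"
    unfolding complex_norm_square[symmetric] by simp
  show "S_prefactor n k \<noteq> 0" using assms by (simp add: S_prefactor_def)
qed

text \<open>The mean of the shifted partition is \<open>psize n \<sigma> / n + (n - 1) / 2\<close>:
  its first term makes the weight traceless, the second centres the Weyl vector.\<close>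

lemma weight_coordinate:
  assumes n: "n \<ge> 1" and \<sigma>: "\<sigma> \<in> box_partitions n k" and i: "i < n"
  shows "fin_weight n \<sigma> (Suc i) + weyl_vector n (Suc i)
    = real (shifted_partition n \<sigma> i) - (\<Sum>j=0..<n. real (shifted_partition n \<sigma> j)) / real n"
proof -
  let ?T = "\<Sum>j=0..<n. real (shifted_partition n \<sigma> j)"
  have "?T = real (psize n \<sigma>) + real (n * (n - 1) div 2)"
    unfolding of_nat_sum[symmetric] sum_shifted_partition[OF n \<sigma>] by simp
  also have "real (n * (n - 1) div 2) = real n * (real n - 1) / 2"
    using n by (subst real_of_nat_div) (auto simp: of_nat_diff)
  finally have "?T / real n = real (psize n \<sigma>) / real n + (real n - 1) / 2"
    using n by (simp add: field_simps)
  then show ?thesis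
    using i by (simp only:) (simp add: fin_weight_def weyl_vector_def shifted_partition_def of_nat_diff)
qed

text \<open>The exponential of the inner product factors over the coordinates, so the alternating
  sum over the Weyl group is the Leibniz formula of a determinant.\<close>

lemma S_matrix_eq_alternant:
  assumes n: "n \<ge> 1" and l: "l \<in> box_partitions n k" and \<sigma>: "\<sigma> \<in> box_partitions n k"
  shows "S_matrix n k l \<sigma> = S_prefactor n k
    * alternant n (torus_point n k (shifted_partition n \<sigma>)) (shifted_partition n l)"
proof -
  define c where "c = - (2 * pi / real (k + n))"
  define x where "x i = fin_weight n \<sigma> i + weyl_vector n i" for i
  define z where "z i = fin_weight n l i + weyl_vector n i" for i
  define s where "s = (\<Sum>j=0..<n. real (shifted_partition n l j)) / real n"
  let ?y = "torus_point n k (shifted_partition n \<sigma>)"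
  have y: "?y i = cis (c * x (Suc i))" if "i < n" for i
    using weight_coordinate[OF n \<sigma> that] by (simp add: x_def c_def torus_point_def)
  have z: "z (Suc j) = real (shifted_partition n l j) - s" if "j < n" for j
    using weight_coordinate[OF n l that] by (simp add: z_def s_def)
  have trm: "exp (- (2 * of_real pi * \<i> / of_nat (k + n)) * of_real (inner_prod n x (weyl_act w z)))
      = (\<Prod>i=1..n. cis (c * (x i * z (inv_into UNIV w i))))" for w
  proof -
    have "exp (- (2 * of_real pi * \<i> / of_nat (k + n)) * of_real (inner_prod n x (weyl_act w z)))
        = cis (c * inner_prod n x (weyl_act w z))"
      by (simp add: cis_conv_exp c_def mult_ac)
    then show ?thesis
      by (simp add: inner_prod_def weyl_act_def sum_distrib_left cis_sum)
  qed
  have "S_matrix n k l \<sigma> = S_prefactor n k * (\<Sum>w | w permutes {1..n}. of_int (sign w) *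
          exp (- (2 * of_real pi * \<i> / of_nat (k + n)) * of_real (inner_prod n x (weyl_act w z))))"
    by (simp add: S_matrix_def S_prefactor_def x_def[abs_def] z_def[abs_def])
  also have "(\<Sum>w | w permutes {1..n}. of_int (sign w) *
          exp (- (2 * of_real pi * \<i> / of_nat (k + n)) * of_real (inner_prod n x (weyl_act w z))))
      = (\<Sum>w | w permutes {1..n}. of_int (sign w) * (\<Prod>i=1..n. cis (c * (x i * z (inv_into UNIV w i)))))"
    by (simp only: trm)
  \<comment> \<open>The Weyl action involves the inverse of \<open>w\<close>; inversion permutes the
    Weyl group and keeps signs.\<close>
  also have "\<dots> = (\<Sum>w | w permutes {1..n}. of_int (sign w) * (\<Prod>i=1..n. cis (c * (x i * z (w i)))))"
  proof (subst sum_permutations_inverse, rule sum.cong[OF refl], clarify)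
    fix w assume w: "w permutes {1..n}"
    have "sign (inv_into UNIV w) = sign w"
      by (rule sign_inverse) (use w in \<open>auto simp: permutation_permutes\<close>)
    then show "of_int (sign (inv_into UNIV w)) * (\<Prod>i=1..n. cis (c * (x i * z (inv_into UNIV (inv_into UNIV w) i))))
      = of_int (sign w) * (\<Prod>i=1..n. cis (c * (x i * z (w i))))"
      by (simp add: permutes_inv_inv[OF w])
  qed
  also have "\<dots> = det (mat n n (\<lambda>(i,j). cis (c * (x (Suc i) * z (Suc j)))))"
    by (rule leibniz_one_based)
  \<comment> \<open>The mean \<open>s\<close> leaves row \<open>i\<close> as a phase. These phases
    multiply to 1 because the coordinates \<open>x (Suc i)\<close> of
    \<open>\<sigma> + \<rho>\<close> sum to 0.\<close>
  also have "\<dots> = det (mat n n (\<lambda>(i,j). cis (- (s * (c * x (Suc i)))) * ?y i ^ shifted_partition n l j))"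
    by (intro arg_cong[where f = det] eq_matI) (auto simp: y z DeMoivre cis_mult algebra_simps)
  also have "\<dots> = (\<Prod>i<n. cis (- (s * (c * x (Suc i))))) * alternant n ?y (shifted_partition n l)"
    unfolding alternant_def by (rule det_scale_rows)
  also have "(\<Prod>i<n. cis (- (s * (c * x (Suc i))))) = 1"
  proof -
    have "(\<Sum>i<n. x (Suc i)) = (\<Sum>i<n. real (shifted_partition n \<sigma> i)
        - (\<Sum>j=0..<n. real (shifted_partition n \<sigma> j)) / real n)"
      by (rule sum.cong) (simp_all add: x_def weight_coordinate[OF n \<sigma>])
    also have "\<dots> = 0" using n by (simp add: sum_subtractf atLeast0LessThan)
    finally have "(\<Sum>i<n. - (s * (c * x (Suc i)))) = 0"
      by (simp add: sum_negf flip: sum_distrib_left)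
    then show ?thesis unfolding cis_sum[symmetric] by simp
  qed
  finally show ?thesis by simp
qed

lemma S_matrix_weight:
  assumes "n \<ge> 2" "m \<in> level_weights n k" "\<sigma> \<in> box_partitions n k"
  shows "S_matrix n k (partition_of_weight n m) \<sigma> = S_prefactor n k
    * alternant n (torus_point n k (shifted_partition n \<sigma>)) (shifted_part n m)"
  unfolding shifted_part_eq using assms by (intro S_matrix_eq_alternant partition_of_weight_in) auto

lemma partition_of_vacuum: "partition_of_weight n (vacuum n k) = (\<lambda>_. 0)"
  by (rule ext) (auto simp: partition_of_weight_def vacuum_def)

text \<open>The vacuum alternant is the Vandermonde product of the torus points. These are distinct,
  as the entries of the shifted partition differ by less than \<open>k + n\<close>. The lemma
  justifies cancelling the denominator of the Verlinde formula.\<close>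

lemma S_matrix_vacuum_nonzero:
  assumes n: "n \<ge> 2" and \<sigma>: "\<sigma> \<in> box_partitions n k"
  shows "S_matrix n k (\<lambda>_. 0) \<sigma> \<noteq> 0"
proof -
  let ?y = "torus_point n k (shifted_partition n \<sigma>)"
  have N: "real (k + n) > 0" using n by simp
  have ne: "?y i \<noteq> ?y j" if ij: "i < j" "j < n" for i j
  proof
    let ?t = "shifted_partition n \<sigma>"
    assume eq: "?y i = ?y j"
    have t: "?t j < ?t i" "?t i < k + n" using shifted_partition_props[OF _ \<sigma>] n ij by auto
    have "cis (- (2 * pi / real (k + n)) * (real (?t i) - real (?t j))) = ?y i / ?y j"
    proof -
      have "r * (a - b) = r * (a - s) - r * (b - s)" for r a b s :: real by (simp add: algebra_simps)
      then show ?thesis unfolding torus_point_def cis_divide by (rule arg_cong)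
    qed
    also have "\<dots> = 1" using eq by (simp add: torus_point_def)
    finally have "cos (- (2 * pi / real (k + n)) * (real (?t i) - real (?t j))) = 1"
      by (metis cis.sel(1) one_complex.sel(1))
    then obtain q :: int where "- (2 * pi / real (k + n)) * (real (?t i) - real (?t j)) = of_int q * 2 * pi"
      unfolding cos_one_2pi_int by blast
    then have "pi * ((real (?t i) - real (?t j)) + of_int q * real (k + n)) = 0"
      using N by (simp add: field_simps)
    then have "real_of_int (int (?t i) - int (?t j)) = of_int (- q * int (k + n))" by simp
    then have "int (?t i) - int (?t j) = - q * int (k + n)" by (simp only: of_int_eq_iff)
    then have "int (k + n) dvd int (?t i) - int (?t j)" by simp
    then show False using zdvd_imp_le[of "int (k + n)" "int (?t i) - int (?t j)"] t by simp
  qed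
  have "alternant n ?y (shifted_part n (vacuum n k)) = (\<Prod>i<n. \<Prod>j\<in>{i<..<n}. ?y i - ?y j)"
  proof -
    have "shifted_part n (vacuum n k) = (\<lambda>j. n - 1 - j)"
      by (rule ext) (simp add: shifted_part_eq partition_of_vacuum shifted_partition_def)
    moreover have "alternant n ?y (\<lambda>j. n - 1 - j) = det (mat n n (\<lambda>(i,j). ?y j ^ (n - 1 - i)))"
    proof -
      have "mat n n (\<lambda>(i,j). ?y i ^ (n - 1 - j)) = transpose_mat (mat n n (\<lambda>(i,j). ?y j ^ (n - 1 - i)))"
        by (rule eq_matI) auto
      then show ?thesis
        unfolding alternant_def by (simp only: det_transpose[of "mat n n (\<lambda>(i,j). ?y j ^ (n - 1 - i))" n] mat_carrier)
    qed
    ultimately show ?thesis by (simp only: det_vandermonde)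
  qed
  also have "\<dots> \<noteq> 0" using ne by auto
  finally show ?thesis
    using S_matrix_weight[OF n vacuum_in \<sigma>] n S_prefactor_norm(2)[of n k]
    by (simp add: partition_of_vacuum)
qed

text \<open>The squared modulus of the prefactor cancels the norm
  \<open>n * (k + n) ^ (n - 1)\<close> of the alternants.\<close>

lemma S_matrix_orthogonal:
  assumes n: "n \<ge> 2" and \<mu>: "\<mu> \<in> level_weights n k" and \<nu>: "\<nu> \<in> level_weights n k"
    and b: "int (psize n (partition_of_weight n \<mu>)) - int (psize n (partition_of_weight n \<nu>)) = int n * b"
  shows "(\<Sum>\<sigma>\<in>box_partitions n k. S_matrix n k (partition_of_weight n \<mu>) \<sigma>
      * cnj (S_matrix n k (partition_of_weight n \<nu>) \<sigma>)) = (if \<mu> = \<nu> then 1 else 0)"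
proof -
  have "(\<Sum>\<sigma>\<in>box_partitions n k. S_matrix n k (partition_of_weight n \<mu>) \<sigma>
      * cnj (S_matrix n k (partition_of_weight n \<nu>) \<sigma>))
    = S_prefactor n k * cnj (S_prefactor n k) * (\<Sum>\<sigma>\<in>box_partitions n k.
        alternant n (torus_point n k (shifted_partition n \<sigma>)) (shifted_part n \<mu>)
      * cnj (alternant n (torus_point n k (shifted_partition n \<sigma>)) (shifted_part n \<nu>)))"
    unfolding sum_distrib_left
    by (intro sum.cong refl) (simp add: S_matrix_weight[OF n \<mu>] S_matrix_weight[OF n \<nu>] mult_ac)
  also have "\<dots> = (if \<mu> = \<nu> then 1 else 0)"
  proof -
    have "(of_nat (k + n) :: complex) \<noteq> 0" using n by (simp only: of_nat_eq_0_iff)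
    then show ?thesis
      unfolding alternant_gram[OF assms] using S_prefactor_norm(1)[of n k] n by (simp del: of_nat_add)
  qed
  finally show ?thesis .
qed

section \<open>Counting lattice configurations\<close>

text \<open>Level weights vanish outside the columns, hence so do the rows of a path; this
  reconciles the columnwise conditions on configurations with equalities of functions.\<close>

lemma configs_eq_paths:
  assumes n: "n \<ge> 2" and \<mu>: "\<mu>h \<in> level_weights n k" and \<nu>: "\<nu>h \<in> level_weights n k"
  shows "configs n \<mu>h \<nu>h = {c \<in> paths n (n - 1) \<mu>h. fst c (n - 1) = \<nu>h}"
proof (intro equalityI subsetI)
  have z: "m j = 0" if "m \<in> level_weights n k" "j \<notin> {1..n}" for m j
    using that by (simp add: level_weights_def)
  {
    fix c assume "c \<in> configs n \<mu>h \<nu>h"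
    then obtain m a where c: "c = (m, a)"
      and m0: "\<And>i j. \<not> (i \<le> n - 1 \<and> j \<in> {1..n}) \<Longrightarrow> m i j = 0"
      and a0: "\<And>i j. \<not> (i \<in> {1..n-1} \<and> j \<in> {1..n}) \<Longrightarrow> a i j = 0"
      and s: "\<And>j. j \<in> {1..n} \<Longrightarrow> m 0 j = \<mu>h j" and e: "\<And>j. j \<in> {1..n} \<Longrightarrow> m (n - 1) j = \<nu>h j"
      and st: "\<And>i j. i \<in> {1..n-1} \<Longrightarrow> j \<in> {1..n} \<Longrightarrow>
          a i j \<le> m (i - 1) j \<and> m i j = m (i - 1) j - a i j + a i (prev_col n j)"
      unfolding configs_def by blast
    have "m 0 = \<mu>h" by (rule ext) (metis s m0 z[OF \<mu>])
    moreover have "m (n - 1) = \<nu>h" by (rule ext) (metis e m0 z[OF \<nu>])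
    moreover have "a 0 = (\<lambda>_. 0)" by (rule ext) (simp add: a0)
    moreover have "m i = (\<lambda>_. 0)" "a i = (\<lambda>_. 0)" if "i > n - 1" for i
      using that by (auto intro!: ext m0 a0)
    moreover have "a (Suc i) \<in> hops_from n (m i)" "m (Suc i) = hop n (m i) (a (Suc i))" if "i < n - 1" for i
    proof -
      have i: "Suc i \<in> {1..n-1}" using that by auto
      show "a (Suc i) \<in> hops_from n (m i)"
        using st[OF i] a0[of "Suc i"] by (simp add: hops_from_def)
      show "m (Suc i) = hop n (m i) (a (Suc i))"
      proof
        fix j
        show "m (Suc i) j = hop n (m i) (a (Suc i)) j"
        proof (cases "j \<in> {1..n}")
          case True
          then show ?thesis using st[OF i True] unfolding hop_def by simp
        next
          case False
          then have "hop n (m i) (a (Suc i)) j = 0" unfolding hop_def by (rule if_not_P)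
          moreover have "m (Suc i) j = 0" using m0 False by blast
          ultimately show ?thesis by simp
        qed
      qed
    qed
    ultimately show "c \<in> {c \<in> paths n (n - 1) \<mu>h. fst c (n - 1) = \<nu>h}"
      by (simp add: c paths_def)
  next
    fix c assume mem: "c \<in> {c \<in> paths n (n - 1) \<mu>h. fst c (n - 1) = \<nu>h}"
    obtain m a where c: "c = (m, a)" by (cases c)
    have p: "(m, a) \<in> paths n (n - 1) \<mu>h" and e: "m (n - 1) = \<nu>h" using mem by (auto simp: c)
    have lev: "m i \<in> level_weights n k" if "i \<le> n - 1" for i
      using paths_level[OF _ \<mu> p that] n by simp
    have row: "a i \<in> hops_from n (m (i - 1))" "m i = hop n (m (i - 1)) (a i)" if "i \<in> {1..n-1}" for i
    proof -
      have "i - 1 < n - 1" "Suc (i - 1) = i" using that by auto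
      then show "a i \<in> hops_from n (m (i - 1))" "m i = hop n (m (i - 1)) (a i)"
        using p unfolding paths_def by auto
    qed
    have "m i j = 0" if "\<not> (i \<le> n - 1 \<and> j \<in> {1..n})" for i j
      using that z[OF lev, of i j] p by (cases "i \<le> n - 1") (auto simp: paths_def)
    moreover have "a i j = 0" if "\<not> (i \<in> {1..n-1} \<and> j \<in> {1..n})" for i j
    proof (cases "i \<in> {1..n-1}")
      case True
      then show ?thesis using row(1)[OF True] that by (simp add: hops_from_def)
    next
      case False
      then have "i = 0 \<or> i > n - 1" by auto
      then show ?thesis using p by (auto simp: paths_def)
    qed
    moreover have "a i j \<le> m (i - 1) j \<and> m i j = m (i - 1) j - a i j + a i (prev_col n j)"
      if ij: "i \<in> {1..n-1}" "j \<in> {1..n}" for i j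
      using row(1)[OF ij(1)] fun_cong[OF row(2)[OF ij(1)], of j] ij(2) unfolding hop_def hops_from_def by simp
    moreover have "m 0 = \<mu>h" using p by (simp add: paths_def)
    ultimately show "c \<in> configs n \<mu>h \<nu>h"
      unfolding c configs_def using e by blast
  }
qed

text \<open>Sums the one-row laws: hops add boxes and passages out of site \<open>n - 1\<close> drop
  full columns, while the first part also grows with each passage from site \<open>n\<close> to site
  1. Eliminating the dropped columns ties the number of hops to the outer edges.\<close>

lemma path_conservation:
  assumes n: "n \<ge> 2" and c: "c \<in> paths n R \<mu>"
  shows "psize n (partition_of_weight n (fst c R)) + n * (\<Sum>i=1..R. snd c i (n - 1))
      = psize n (partition_of_weight n \<mu>) + hop_count n R c"
    "tail_sum n (fst c R) 0 + (\<Sum>i=1..R. snd c i (n - 1)) = tail_sum n \<mu> 0 + (\<Sum>i=1..R. snd c i n)"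
proof -
  have row: "snd c (Suc i) \<in> hops_from n (fst c i)" "fst c (Suc i) = hop n (fst c i) (snd c (Suc i))"
    if "i < R" for i using c that by (auto simp: paths_def)
  have start: "fst c 0 = \<mu>" using c by (auto simp: paths_def)
  have "psize n (partition_of_weight n (fst c r)) + n * (\<Sum>i=1..r. snd c i (n - 1))
      = psize n (partition_of_weight n \<mu>) + hop_count n r c
    \<and> tail_sum n (fst c r) 0 + (\<Sum>i=1..r. snd c i (n - 1)) = tail_sum n \<mu> 0 + (\<Sum>i=1..r. snd c i n)"
    if "r \<le> R" for r
    using that
  proof (induction r)
    case 0
    then show ?case by (simp add: start hop_count_def)
  next
    case (Suc r)
    then have r: "r < R" by simp
    have "prev_col n (Suc 0) = n" by (simp add: prev_col_def)
    then show ?case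
      using Suc psize_hop[OF n row(1)[OF r]] tail_sum_hop[OF n row(1)[OF r], of 0] n row(2)[OF r]
      by (simp add: hop_count_def algebra_simps)
  qed
  from this[OF order_refl]
  show "psize n (partition_of_weight n (fst c R)) + n * (\<Sum>i=1..R. snd c i (n - 1))
      = psize n (partition_of_weight n \<mu>) + hop_count n R c"
    "tail_sum n (fst c R) 0 + (\<Sum>i=1..R. snd c i (n - 1)) = tail_sum n \<mu> 0 + (\<Sum>i=1..R. snd c i n)"
    by simp_all
qed

section \<open>The Verlinde formula and the count\<close>

text \<open>The exchange identity between \<open>\<mu>\<close> and the vacuum, divided by the vacuum
  alternant, with the vacuum paths counted by \<open>gl_dim\<close>.\<close>

lemma S_matrix_paths:
  assumes n: "n \<ge> 2" and \<mu>: "\<mu> \<in> level_weights n k" and \<sigma>: "\<sigma> \<in> box_partitions n k"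
  shows "S_matrix n k (partition_of_weight n \<mu>) \<sigma> / S_matrix n k (\<lambda>_. 0) \<sigma> *
      (\<Sum>m | m \<in> level_weights n k \<and> psize n (partition_of_weight n m) = A.
         gl_dim n (n - 1) m * S_matrix n k (partition_of_weight n m) \<sigma>)
    = (\<Sum>p | p \<in> paths n (n - 1) \<mu> \<and> hop_count n (n - 1) p = A.
         S_matrix n k (partition_of_weight n (fst p (n - 1))) \<sigma>)"
proof -
  let ?y = "torus_point n k (shifted_partition n \<sigma>)"
  let ?S = "\<lambda>m. S_matrix n k (partition_of_weight n m) \<sigma>"
  let ?\<psi> = "\<lambda>m. alternant n ?y (shifted_part n m)"
  have n1: "n \<ge> 1" using n by simp
  have vac: "vacuum n k \<in> level_weights n k" by (rule vacuum_in[OF n1])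
  have S: "?S m = S_prefactor n k * ?\<psi> m" if "m \<in> level_weights n k" for m
    by (rule S_matrix_weight[OF n that \<sigma>])
  have S0: "S_matrix n k (\<lambda>_. 0) \<sigma> = S_prefactor n k * ?\<psi> (vacuum n k)"
    using S[OF vac] by (simp add: partition_of_vacuum)
  have Sp: "(\<Sum>p | p \<in> paths n (n - 1) \<tau> \<and> hop_count n (n - 1) p = A. ?S (fst p (n - 1)))
      = S_prefactor n k * (\<Sum>p | p \<in> paths n (n - 1) \<tau> \<and> hop_count n (n - 1) p = A. ?\<psi> (fst p (n - 1)))"
    if "\<tau> \<in> level_weights n k" for \<tau>
    unfolding sum_distrib_left by (intro sum.cong refl S paths_level[OF n1 that]) auto
  have ex: "?\<psi> (vacuum n k) * (\<Sum>p | p \<in> paths n (n - 1) \<mu> \<and> hop_count n (n - 1) p = A. ?\<psi> (fst p (n - 1)))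
      = ?\<psi> \<mu> * (\<Sum>p | p \<in> paths n (n - 1) (vacuum n k) \<and> hop_count n (n - 1) p = A. ?\<psi> (fst p (n - 1)))"
    by (rule alternant_paths_exchange[OF n \<mu> vac torus_point_prod[OF n1] torus_point_power[OF n1]])
  have "(\<Sum>p | p \<in> paths n (n - 1) (vacuum n k) \<and> hop_count n (n - 1) p = A. ?S (fst p (n - 1)))
      = (\<Sum>p\<in>paths n (n - 1) (vacuum n k). if hop_count n (n - 1) p = A then ?S (fst p (n - 1)) else 0)"
    by (rule sum.inter_filter[OF finite_paths])
  also have "\<dots> = (\<Sum>m\<in>short_weights n k (n - 1). gl_dim n (n - 1) m *
      (if psize n (partition_of_weight n m) = A then ?S m else 0))"
    using n by (intro sum_paths_vacuum[where F = "\<lambda>m h. if h = A then ?S m else 0"]) auto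
  also have "\<dots> = (\<Sum>m | m \<in> level_weights n k \<and> psize n (partition_of_weight n m) = A. gl_dim n (n - 1) m * ?S m)"
    unfolding short_weights_all[OF n1]
    by (subst sum.inter_filter[OF finite_level_weights]) (rule sum.cong[OF refl], simp)
  finally have vacS: "(\<Sum>m | m \<in> level_weights n k \<and> psize n (partition_of_weight n m) = A. gl_dim n (n - 1) m * ?S m)
      = S_prefactor n k * (\<Sum>p | p \<in> paths n (n - 1) (vacuum n k) \<and> hop_count n (n - 1) p = A. ?\<psi> (fst p (n - 1)))"
    unfolding Sp[OF vac] by simp
  have "?\<psi> (vacuum n k) \<noteq> 0" "S_prefactor n k \<noteq> 0"
    using S_matrix_vacuum_nonzero[OF n \<sigma>] unfolding S0 by auto
  then show ?thesis
    unfolding vacS Sp[OF \<mu>] S[OF \<mu>] S0 using ex by (simp add: field_simps)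
qed

text \<open>After inserting the Verlinde formula and exchanging sums, orthogonality keeps the paths
  ending at \<open>\<nu>h\<close>. The assumption on \<open>A\<close> makes the size of every
  endpoint agree with that of \<open>\<nu>h\<close> modulo \<open>n\<close>, as
  \<open>S_matrix_orthogonal\<close> requires.\<close>

lemma sum_fusion_gl_dim:
  assumes n: "n \<ge> 2" and \<mu>: "\<mu>h \<in> level_weights n k" and \<nu>: "\<nu>h \<in> level_weights n k"
    and A: "int (psize n (partition_of_weight n \<mu>h)) + int A - int (psize n (partition_of_weight n \<nu>h)) = int n * b"
  shows "(\<Sum>m | m \<in> level_weights n k \<and> psize n (partition_of_weight n m) = A.
      fusion n k (partition_of_weight n m) (partition_of_weight n \<mu>h) (partition_of_weight n \<nu>h) * gl_dim n (n - 1) m)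
    = of_nat (card {p \<in> paths n (n - 1) \<mu>h. hop_count n (n - 1) p = A \<and> fst p (n - 1) = \<nu>h})"
proof -
  let ?pw = "partition_of_weight n"
  let ?P = "{p. p \<in> paths n (n - 1) \<mu>h \<and> hop_count n (n - 1) p = A}"
  let ?M = "{m. m \<in> level_weights n k \<and> psize n (?pw m) = A}"
  have finP: "finite ?P" using finite_paths by simp
  have "(\<Sum>m\<in>?M. fusion n k (?pw m) (?pw \<mu>h) (?pw \<nu>h) * gl_dim n (n - 1) m)
    = (\<Sum>\<sigma>\<in>box_partitions n k. (S_matrix n k (?pw \<mu>h) \<sigma> / S_matrix n k (\<lambda>_. 0) \<sigma> *
        (\<Sum>m\<in>?M. gl_dim n (n - 1) m * S_matrix n k (?pw m) \<sigma>)) * cnj (S_matrix n k (?pw \<nu>h) \<sigma>))"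
    unfolding fusion_def sum_distrib_left sum_distrib_right
    by (subst sum.swap) (simp add: mult_ac)
  also have "\<dots> = (\<Sum>\<sigma>\<in>box_partitions n k. (\<Sum>p\<in>?P. S_matrix n k (?pw (fst p (n - 1))) \<sigma>) * cnj (S_matrix n k (?pw \<nu>h) \<sigma>))"
    by (rule sum.cong[OF refl]) (simp only: S_matrix_paths[OF n \<mu>])
  also have "\<dots> = (\<Sum>p\<in>?P. \<Sum>\<sigma>\<in>box_partitions n k. S_matrix n k (?pw (fst p (n - 1))) \<sigma> * cnj (S_matrix n k (?pw \<nu>h) \<sigma>))"
    unfolding sum_distrib_right by (rule sum.swap)
  also have "\<dots> = (\<Sum>p\<in>?P. if fst p (n - 1) = \<nu>h then 1 else 0)"
  proof (rule sum.cong[OF refl])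
    fix p assume p: "p \<in> ?P"
    then have lev: "fst p (n - 1) \<in> level_weights n k" using paths_level[OF _ \<mu>, of p "n - 1" "n - 1"] n by simp
    have "psize n (?pw (fst p (n - 1))) + n * (\<Sum>i=1..n-1. snd p i (n - 1)) = psize n (?pw \<mu>h) + A"
      using path_conservation(1)[OF n, of p "n - 1" \<mu>h] p by simp
    then have "int (psize n (?pw (fst p (n - 1)))) + int n * int (\<Sum>i=1..n-1. snd p i (n - 1))
        = int (psize n (?pw \<mu>h)) + int A"
      by (metis of_nat_add of_nat_mult)
    then have "int (psize n (?pw (fst p (n - 1)))) - int (psize n (?pw \<nu>h))
        = int n * (b - int (\<Sum>i=1..n-1. snd p i (n - 1)))"
      using A by (simp add: right_diff_distrib)
    then show "(\<Sum>\<sigma>\<in>box_partitions n k. S_matrix n k (?pw (fst p (n - 1))) \<sigma> * cnj (S_matrix n k (?pw \<nu>h) \<sigma>))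
        = (if fst p (n - 1) = \<nu>h then 1 else 0)"
      by (rule S_matrix_orthogonal[OF n lev \<nu>])
  qed
  also have "\<dots> = of_nat (card {p \<in> ?P. fst p (n - 1) = \<nu>h})"
    unfolding sum.inter_filter[OF finP, symmetric] by simp
  also have "{p \<in> ?P. fst p (n - 1) = \<nu>h} = {p \<in> paths n (n - 1) \<mu>h. hop_count n (n - 1) p = A \<and> fst p (n - 1) = \<nu>h}"
    by auto
  finally show ?thesis .
qed

theorem corollary2p3:
  fixes n k d :: nat and \<mu>h \<nu>h \<mu> \<nu> :: "nat \<Rightarrow> nat"
  assumes "2 \<le> n"
    and "\<mu>h \<in> level_weights n k" and "\<nu>h \<in> level_weights n k"
    and "\<mu> = partition_of_weight n \<mu>h" and "\<nu> = partition_of_weight n \<nu>h"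
  shows "(of_nat (card (configs_outer n \<mu>h \<nu>h d)) :: complex) =
    (\<Sum>lamh \<in> {lamh \<in> level_weights n k.
          real d = (real (psize n (partition_of_weight n lamh)) + real (psize n \<mu>) - real (psize n \<nu>))
                     / real n + real (\<nu> 1) - real (\<mu> 1)}.
       fusion n k (partition_of_weight n lamh) \<mu> \<nu> *
       (\<Prod>s \<in> young_diagram n (partition_of_weight n lamh).
          of_int (int n - 1 + content s) / of_int (hook n (partition_of_weight n lamh) s)))"
proof -
  note n = assms(1) and \<mu>h = assms(2) and \<nu>h = assms(3)
  let ?pw = "partition_of_weight n"
  \<comment> \<open>The size of \<open>\<lambda>\<close> prescribed by the condition on
    \<open>d\<close>; it is an integer because it may be negative.\<close>
  define A :: int where "A = int (psize n \<nu>) - int (psize n \<mu>) + int n * (int d + int (\<mu> 1) - int (\<nu> 1))"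
  have first: "\<mu> 1 = tail_sum n \<mu>h 0" "\<nu> 1 = tail_sum n \<nu>h 0"
    using partition_of_weight_eq_tail_sum[of n _ 0] by (simp_all add: assms(4,5))
  \<comment> \<open>Eliminating the dropped columns \<open>Q\<close> from the two conservation laws
    leaves \<open>hop_count n (n - 1) c - A = n * (D - d)\<close>, where \<open>D\<close> counts the
    boundary passages.\<close>
  have outer: "outer_edges n c = 2 * d \<longleftrightarrow> int (hop_count n (n - 1) c) = A"
    if c: "c \<in> paths n (n - 1) \<mu>h" "fst c (n - 1) = \<nu>h" for c
  proof -
    define Q where "Q = (\<Sum>i=1..n-1. snd c i (n - 1))"
    define D where "D = (\<Sum>i=1..n-1. snd c i n)"
    have 1: "int (psize n \<nu>) + int n * int Q = int (psize n \<mu>) + int (hop_count n (n - 1) c)"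
      using path_conservation(1)[OF n c(1)] c(2) unfolding Q_def assms(4,5)
      by (metis of_nat_add of_nat_mult)
    have 2: "int Q = int (\<mu> 1) + int D - int (\<nu> 1)"
    proof -
      have "\<nu> 1 + Q = \<mu> 1 + D"
        using path_conservation(2)[OF n c(1)] c(2) by (simp only: Q_def D_def first)
      then show ?thesis by linarith
    qed
    have "int (hop_count n (n - 1) c) - A = int n * (int D - int d)"
      using 1 unfolding 2 A_def by (simp add: algebra_simps)
    then have "int (hop_count n (n - 1) c) = A \<longleftrightarrow> D = d"
      using n by (metis cancel_comm_monoid_add_class.diff_cancel eq_iff_diff_eq_0 mult_eq_0_iff of_nat_0_eq_iff of_nat_eq_iff not_numeral_le_zero)
    moreover have "outer_edges n c = 2 * D" by (simp add: outer_edges_def D_def case_prod_beta)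
    ultimately show ?thesis by simp
  qed
  have lhs: "configs_outer n \<mu>h \<nu>h d
      = {p \<in> paths n (n - 1) \<mu>h. int (hop_count n (n - 1) p) = A \<and> fst p (n - 1) = \<nu>h}"
    unfolding configs_outer_def configs_eq_paths[OF n \<mu>h \<nu>h] using outer by blast
  have cond: "real d = (real (psize n (?pw m)) + real (psize n \<mu>) - real (psize n \<nu>)) / real n + real (\<nu> 1) - real (\<mu> 1)
      \<longleftrightarrow> int (psize n (?pw m)) = A" for m
  proof -
    have "real d = (real (psize n (?pw m)) + real (psize n \<mu>) - real (psize n \<nu>)) / real n + real (\<nu> 1) - real (\<mu> 1)
      \<longleftrightarrow> real_of_int (int (psize n (?pw m))) = real_of_int A"
      using n unfolding A_def by (simp add: field_simps) linarith
    then show ?thesis by (simp only: of_int_eq_iff)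
  qed
  show ?thesis
  proof (cases "A \<ge> 0")
    case True
    then obtain B where B: "A = int B" using nonneg_int_cases by blast
    have eq: "int (psize n (?pw \<mu>h)) + int B - int (psize n (?pw \<nu>h)) = int n * (int d + int (\<mu> 1) - int (\<nu> 1))"
      using B by (simp add: A_def assms(4,5))
    show ?thesis
      unfolding lhs cond unfolding B of_nat_eq_iff sum_fusion_gl_dim[OF n \<mu>h \<nu>h eq, symmetric] assms(4,5)
      by (intro sum.cong) (auto simp only: gl_dim_eq_hook_content[OF n] mem_Collect_eq)
  next
    case False
    \<comment> \<open>A negative \<open>A\<close> is neither a number of hops nor a size, so both
      sides are 0.\<close>
    then have "int x \<noteq> A" for x by auto
    then show ?thesis unfolding lhs cond by simp
  qed
qed

end
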